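(* Let $q$ be a prime power, $t\ge 2$ an integer, $\alpha$ a primitive element of $\mathbb{F}_{q^t}$, and $v$ a positive divisor of $q-1$. Let $C\subseteq[0,q^t-2]$ be such that the following equivalent statements hold: 1. the $q^t\times|C|$ array $\mathcal{A}_{\mathbf 0}(\alpha,C)$ is a linear $\mathrm{OA}_q(t-1,|C|,q)$; 2. the set $\{\alpha^c\mid c\in C\}$ is a $(|C|,t-1)$-set over $\mathbb{F}_q$; 3. the set $\{L^c_{q^t-1}(\mathrm{Seq}(\alpha))\mid c\in C\}$ is a $(|C|,t-1)$-set over $\mathbb{F}_q$; 4. for every (distinct) $c_0,\dots,c_{t-2}\in C$ and $d_0,\dots,d_{t-2}\in\mathbb{F}_q$ not all zero, the minimal polynomial of $\alpha$ over $\mathbb{F}_q$ does not divide $\sum_{j=0}^{t-2}d_jx^{c_j}$; 5. for every $t-1$ points in $\{[\alpha^c]\mid c\in C\}$, there is no $(t-3)$-flat in $PG(t-1,q)$ that contains them. If furthermore $$q^{\frac t2-2}(q-tv)\ \ge\ v^{t-1},$$ then the array $\mathcal{A}_{q^t/q}(\alpha,C;v)$ is a covering array $\mathrm{CA}(v[t]_q;\,t,\,|C|,\,v)$.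
   Context: For integers $a\le b$, $[a,b]=\{a,a+1,\dots,b\}$. $[t]_q=(q^t-1)/(q-1)$. A primitive element of a finite field is a generator of its multiplicative group. $\mathrm{Tr}(x)=x+x^q+\dots+x^{q^{t-1}}$ is the trace from $\mathbb{F}_{q^t}$ to $\mathbb{F}_q$. Let $C=\{c_0,\dots,c_{k-1}\}$ be an ordered subset of $[0,q^t-2]$. The array $\mathcal{A}_{\mathbf 0}(\alpha,C)$ is the $q^t\times k$ array over $\mathbb{F}_q$ whose row $i$, for $i\in[0,q^t-2]$, is $(\mathrm{Tr}(\alpha^{i+c_0}),\dots,\mathrm{Tr}(\alpha^{i+c_{k-1}}))$ and whose last row is all zeros. $\mathrm{Seq}(\alpha)=(\mathrm{Tr}(\alpha^i))_{i\ge0}$, and $L^c_n(\mathrm{Seq}(\alpha))=(\mathrm{Tr}(\alpha^{i+c}))_{i=0}^{n-1}\in\mathbb{F}_q^n$. The element $\omega=\alpha^{[t]_q}$ is a primitive element of $\mathbb{F}_q$; for $x\in\mathbb{F}_q^\times$, $\log_\omega(x)$ is the unique $j\in[0,q-2]$ with $\omega^j=x$. The array $\mathcal{A}_{q^t/q}(\alpha,C;v)$ is the $v[t]_q\times k$ array with entries in $\{0,\dots,v-1\}$ whose $(i,j)$ entry, $i\in[0,v[t]_q-1]$, $j\in[0,k-1]$, is $\log_\omega(\mathrm{Tr}(\alpha^{i+c_j}))\bmod v$ if $\mathrm{Tr}(\alpha^{i+c_j})\ne0$, and $0$ otherwise. An orthogonal array $\mathrm{OA}_\lambda(s,k,v)$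 ($s\le k$) is a $\lambda v^s\times k$ array over an alphabet $V$ of size $v$ such that for every $s$ columns, each element of $V^s$ occurs exactly $\lambda$ times as a row of the subarray formed by these columns. An $\mathrm{OA}_\lambda(s,k,q)$ with entries in $\mathbb{F}_q$ is called linear if its row vectors are distinct and form a subspace of $\mathbb{F}_q^k$. A covering array $\mathrm{CA}(N;t,k,v)$ ($t\le k$) is an $N\times k$ array over an alphabet $V$ of size $v$ such that for every $t$ columns, each element of $V^t$ occurs at least once as a row of the corresponding subarray. A $(k,s)$-set over a field $F$ ($s\le k$) is a set of $k$ elements of an $F$-vector space every subset of size $s$ of which is linearly independent over $F$. $PG(t-1,q)$ is the projective space whose points are the one-dimensional $\mathbb{F}_q$-subspaces of $\mathbb{F}_{q^t}$; $[x]$ is the point represented by $x\ne0$. A $k$-flat is the set of points $\{[x]\mid x\in S\setminus\{0\}\}$ for an $\mathbb{F}_q$-subspace $S$ of dimension $k+1$.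
   Formalization: Statement 1 is shown equivalent to 2 plus distinct rows (1⇔2 fails for q=3, t=2, C={0,4}); without row distinctness it is equivalent to 2. |C|≥t−1 is assumed, and |C|≥t for the covering array; in 5 the t−1 points come from distinct exponents c and may coincide. *)

theory Defs
  imports
    Complex_Main
    "HOL-Library.Cardinality"
    "HOL-Library.FuncSet"
    "HOL-Library.Function_Algebras"
    "HOL-Computational_Algebra.Polynomial"
begin

text \<open>
  The field extension is given by two finite field types with a field embedding \<open>\<iota>\<close> of the
  small field (of \<open>q\<close> elements) into the large one (of \<open>q ^ t\<close> elements).
\<close>

definition field_embedding :: "('f::field \<Rightarrow> 'e::field) \<Rightarrow> bool" where
  "field_embedding \<iota> \<longleftrightarrow>
     \<iota> 1 = 1 \<and> (\<forall>a b. \<iota> (a + b) = \<iota> a + \<iota> b) \<and> (\<forall>a b. \<iota> (a * b) = \<iota> a * \<iota> b)"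

definition ext_scale :: "('f::field \<Rightarrow> 'e::field) \<Rightarrow> 'f \<Rightarrow> 'e \<Rightarrow> 'e" where
  "ext_scale \<iota> a x = \<iota> a * x"

lemma vector_space_ext_scale: "field_embedding \<iota> \<Longrightarrow> vector_space (ext_scale \<iota>)"
  by unfold_locales (simp_all add: field_embedding_def ext_scale_def algebra_simps)

text \<open>
  A vector of length \<open>n\<close> is a function on the naturals that vanishes from \<open>n\<close> on; addition and
  zero are the pointwise ones of \<^theory>\<open>HOL-Library.Function_Algebras\<close>.
\<close>

definition tuple :: "nat \<Rightarrow> (nat \<Rightarrow> 'a::zero) \<Rightarrow> nat \<Rightarrow> 'a" where
  "tuple n f = (\<lambda>i. if i < n then f i else 0)"

definition fun_scale :: "'a::field \<Rightarrow> (nat \<Rightarrow> 'a) \<Rightarrow> nat \<Rightarrow> 'a" where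
  "fun_scale a f = (\<lambda>i. a * f i)"

lemma vector_space_fun_scale: "vector_space fun_scale"
  by unfold_locales (simp_all add: fun_scale_def fun_eq_iff algebra_simps)

definition is_ks_set :: "('a::field \<Rightarrow> 'b::ab_group_add \<Rightarrow> 'b) \<Rightarrow> nat \<Rightarrow> nat \<Rightarrow> 'b set \<Rightarrow> bool" where
  "is_ks_set scale k s X \<longleftrightarrow>
     s \<le> k \<and> finite X \<and> card X = k \<and>
     (\<forall>Y\<subseteq>X. card Y = s \<longrightarrow> \<not> module.dependent scale Y)"

text \<open>
  An \<open>N \<times> k\<close> array is a function of a row index \<open>i < N\<close> and a column index \<open>j < k\<close>.
\<close>

definition orthogonal_array ::
  "nat \<Rightarrow> nat \<Rightarrow> nat \<Rightarrow> nat \<Rightarrow> nat \<Rightarrow> 'a set \<Rightarrow> (nat \<Rightarrow> nat \<Rightarrow> 'a) \<Rightarrow> bool" where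
  "orthogonal_array N l s k v V A \<longleftrightarrow>
     s \<le> k \<and> finite V \<and> card V = v \<and> N = l * v ^ s \<and>
     (\<forall>i<N. \<forall>j<k. A i j \<in> V) \<and>
     (\<forall>J\<subseteq>{..<k}. card J = s \<longrightarrow>
        (\<forall>f\<in>J \<rightarrow>\<^sub>E V. card {i. i < N \<and> (\<forall>j\<in>J. A i j = f j)} = l))"

definition covering_array ::
  "nat \<Rightarrow> nat \<Rightarrow> nat \<Rightarrow> nat \<Rightarrow> 'a set \<Rightarrow> (nat \<Rightarrow> nat \<Rightarrow> 'a) \<Rightarrow> bool" where
  "covering_array N s k v V A \<longleftrightarrow>
     s \<le> k \<and> finite V \<and> card V = v \<and>
     (\<forall>i<N. \<forall>j<k. A i j \<in> V) \<and>
     (\<forall>J\<subseteq>{..<k}. card J = s \<longrightarrow>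
        (\<forall>f\<in>J \<rightarrow>\<^sub>E V. \<exists>i<N. \<forall>j\<in>J. A i j = f j))"

definition rows_distinct :: "nat \<Rightarrow> nat \<Rightarrow> (nat \<Rightarrow> nat \<Rightarrow> 'a::zero) \<Rightarrow> bool" where
  "rows_distinct N k A \<longleftrightarrow> inj_on (\<lambda>i. tuple k (A i)) {..<N}"

definition rows_subspace :: "nat \<Rightarrow> nat \<Rightarrow> (nat \<Rightarrow> nat \<Rightarrow> 'a::field) \<Rightarrow> bool" where
  "rows_subspace N k A \<longleftrightarrow> module.subspace fun_scale ((\<lambda>i. tuple k (A i)) ` {..<N})"

definition linear_orthogonal_array ::
  "nat \<Rightarrow> nat \<Rightarrow> nat \<Rightarrow> nat \<Rightarrow> (nat \<Rightarrow> nat \<Rightarrow> 'f::{field,finite}) \<Rightarrow> bool" where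
  "linear_orthogonal_array N l s k A \<longleftrightarrow>
     orthogonal_array N l s k CARD('f) UNIV A \<and> rows_distinct N k A \<and> rows_subspace N k A"

definition primitive_element :: "'e::{field,finite} \<Rightarrow> bool" where
  "primitive_element \<alpha> \<longleftrightarrow> range (\<lambda>n::nat. \<alpha> ^ n) = UNIV - {0}"

definition qnum :: "nat \<Rightarrow> nat \<Rightarrow> nat" where
  "qnum q t = (q ^ t - 1) div (q - 1)"

text \<open>
  The trace is an element of the small field: the preimage under \<open>\<iota>\<close> of the usual sum, which lies
  in the range of \<open>\<iota>\<close> when the large field has \<open>q ^ t\<close> elements.
\<close>

definition Tr :: "('f::{field,finite} \<Rightarrow> 'e::{field,finite}) \<Rightarrow> nat \<Rightarrow> 'e \<Rightarrow> 'f" where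
  "Tr \<iota> t x = inv \<iota> (\<Sum>i<t. x ^ (CARD('f) ^ i))"

definition array_zero ::
  "('f::{field,finite} \<Rightarrow> 'e::{field,finite}) \<Rightarrow> nat \<Rightarrow> 'e \<Rightarrow> nat list \<Rightarrow> nat \<Rightarrow> nat \<Rightarrow> 'f" where
  "array_zero \<iota> t \<alpha> cs i j =
     (if i < CARD('f) ^ t - 1 then Tr \<iota> t (\<alpha> ^ (i + cs ! j)) else 0)"

definition subinterval ::
  "('f::{field,finite} \<Rightarrow> 'e::{field,finite}) \<Rightarrow> nat \<Rightarrow> 'e \<Rightarrow> nat \<Rightarrow> nat \<Rightarrow> nat \<Rightarrow> 'f" where
  "subinterval \<iota> t \<alpha> n c = tuple n (\<lambda>i. Tr \<iota> t (\<alpha> ^ (i + c)))"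

definition omega :: "('f::{field,finite} \<Rightarrow> 'e::{field,finite}) \<Rightarrow> nat \<Rightarrow> 'e \<Rightarrow> 'f" where
  "omega \<iota> t \<alpha> = inv \<iota> (\<alpha> ^ qnum CARD('f) t)"

definition dlog :: "'f::{field,finite} \<Rightarrow> 'f \<Rightarrow> nat" where
  "dlog w x = (THE j. j \<le> CARD('f) - 2 \<and> w ^ j = x)"

definition array_log ::
  "('f::{field,finite} \<Rightarrow> 'e::{field,finite}) \<Rightarrow> nat \<Rightarrow> 'e \<Rightarrow> nat list \<Rightarrow> nat \<Rightarrow> nat \<Rightarrow> nat \<Rightarrow> nat" where
  "array_log \<iota> t \<alpha> cs v i j =
     (let x = Tr \<iota> t (\<alpha> ^ (i + cs ! j)) in
      if x \<noteq> 0 then dlog (omega \<iota> t \<alpha>) x mod v else 0)"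

definition min_poly :: "('f::field \<Rightarrow> 'e::field) \<Rightarrow> 'e \<Rightarrow> 'f poly" where
  "min_poly \<iota> x =
     (THE p. lead_coeff p = 1 \<and> poly (map_poly \<iota> p) x = 0 \<and>
        (\<forall>r. r \<noteq> 0 \<and> poly (map_poly \<iota> r) x = 0 \<longrightarrow> degree p \<le> degree r))"

definition proj_point :: "('f::field \<Rightarrow> 'e::field) \<Rightarrow> 'e \<Rightarrow> 'e set" where
  "proj_point \<iota> x = module.span (ext_scale \<iota>) {x}"

text \<open>
  The dimension of a flat is an integer, as the case \<open>t = 2\<close> below involves the empty flat, of
  dimension \<open>-1\<close>.
\<close>

definition is_flat :: "('f::field \<Rightarrow> 'e::field) \<Rightarrow> int \<Rightarrow> 'e set set \<Rightarrow> bool" where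
  "is_flat \<iota> k F \<longleftrightarrow>
     (\<exists>S. module.subspace (ext_scale \<iota>) S \<and> int (vector_space.dim (ext_scale \<iota>) S) = k + 1 \<and>
        F = proj_point \<iota> ` (S - {0}))"

definition linear_oa_condition ::
  "('f::{field,finite} \<Rightarrow> 'e::{field,finite}) \<Rightarrow> nat \<Rightarrow> 'e \<Rightarrow> nat list \<Rightarrow> bool" where
  "linear_oa_condition \<iota> t \<alpha> cs \<longleftrightarrow>
     linear_orthogonal_array (CARD('f) ^ t) CARD('f) (t - 1) (length cs) (array_zero \<iota> t \<alpha> cs)"

definition power_set_condition ::
  "('f::{field,finite} \<Rightarrow> 'e::{field,finite}) \<Rightarrow> nat \<Rightarrow> 'e \<Rightarrow> nat list \<Rightarrow> bool" where
  "power_set_condition \<iota> t \<alpha> cs \<longleftrightarrow>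
     is_ks_set (ext_scale \<iota>) (length cs) (t - 1) ((\<lambda>c. \<alpha> ^ c) ` set cs)"

definition sequence_condition ::
  "('f::{field,finite} \<Rightarrow> 'e::{field,finite}) \<Rightarrow> nat \<Rightarrow> 'e \<Rightarrow> nat list \<Rightarrow> bool" where
  "sequence_condition \<iota> t \<alpha> cs \<longleftrightarrow>
     is_ks_set fun_scale (length cs) (t - 1) (subinterval \<iota> t \<alpha> (CARD('f) ^ t - 1) ` set cs)"

definition min_poly_condition ::
  "('f::{field,finite} \<Rightarrow> 'e::{field,finite}) \<Rightarrow> nat \<Rightarrow> 'e \<Rightarrow> nat list \<Rightarrow> bool" where
  "min_poly_condition \<iota> t \<alpha> cs \<longleftrightarrow>
     (\<forall>(c :: nat \<Rightarrow> nat) (d :: nat \<Rightarrow> 'f).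
        inj_on c {..t - 2} \<and> c ` {..t - 2} \<subseteq> set cs \<and> (\<exists>j\<le>t - 2. d j \<noteq> 0) \<longrightarrow>
        \<not> min_poly \<iota> \<alpha> dvd (\<Sum>j\<le>t - 2. monom (d j) (c j)))"

text \<open>
  The points are indexed by distinct exponents, and so may coincide: proportional powers of
  \<open>\<alpha>\<close> have to violate the condition.
\<close>

definition flat_condition ::
  "('f::{field,finite} \<Rightarrow> 'e::{field,finite}) \<Rightarrow> nat \<Rightarrow> 'e \<Rightarrow> nat list \<Rightarrow> bool" where
  "flat_condition \<iota> t \<alpha> cs \<longleftrightarrow>
     (\<forall>D\<subseteq>set cs. card D = t - 1 \<longrightarrow>
        \<not> (\<exists>F. is_flat \<iota> (int t - 3) F \<and> (\<forall>c\<in>D. proj_point \<iota> (\<alpha> ^ c) \<in> F)))"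

end

theory Submission
  imports Defs
begin

text \<open>
  The trace pairing \<open>(z, x) \<mapsto> Tr (z x)\<close> is non-degenerate, so linear independence of the
  powers \<open>\<alpha> ^ c\<close> is the same as equidistribution (or just surjectivity) of \<open>z \<mapsto> (Tr (z \<alpha> ^ c))\<^sub>c\<close>.
  This gives the equivalences.

  For the covering array, fix \<open>t\<close> columns. If the \<open>\<alpha> ^ c\<close> are independent, all trace vectors occur.
  Otherwise there is one relation, with all coefficients \<open>a\<^sub>c\<close> non-zero, and the trace vectors are
  exactly the solutions of \<open>\<Sum> a\<^sub>c y\<^sub>c = 0\<close>; a solution is needed in which every \<open>y\<^sub>c\<close> lies in a
  prescribed coset of the group \<open>K\<close> of \<open>v\<close>-th powers. Convolution with the indicator of a coset of
  \<open>K\<close> has norm at most \<open>\<surd>q\<close> on functions of mean zero, which bounds the error term when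
  counting such solutions. Multiplying \<open>z\<close> by \<open>\<alpha> ^ (v [t]\<^sub>q)\<close> multiplies
  every trace by \<open>\<omega> ^ v\<close>, so the first \<open>v [t]\<^sub>q\<close> rows suffice.
\<close>

section \<open>Linear equations over cosets of a multiplicative subgroup\<close>

lemma sum_UNIV_shift:
  fixes g :: "'a::{ab_group_add,finite} \<Rightarrow> 'b::comm_monoid_add"
  shows "(\<Sum>x\<in>UNIV. g (x - c)) = sum g UNIV"
  by (rule sum.reindex_bij_witness[where i = "\<lambda>x. x + c" and j = "\<lambda>x. x - c"]) simp_all

lemma sum_UNIV_affine:
  fixes g :: "'a::{field,finite} \<Rightarrow> 'b::comm_monoid_add"
  assumes "d \<noteq> 0"
  shows "(\<Sum>s\<in>UNIV. g (x + s * d)) = sum g UNIV"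
  by (rule sum.reindex_bij_witness[where i = "\<lambda>y. (y - x) / d" and j = "\<lambda>s. x + s * d"])
     (use assms in auto)

text \<open>Translating \<open>x\<close> by \<open>s * k\<close> leaves the autocorrelation of
  \<open>g\<close> at \<open>s * (k - l)\<close>. For \<open>k \<noteq> l\<close> this argument runs
  through the whole field as \<open>s\<close> does, so the sum over \<open>s\<close> is
  \<open>sum g UNIV = 0\<close>.\<close>

lemma sum_shifted_product:
  fixes g :: "'a::{field,finite} \<Rightarrow> real"
  assumes "sum g UNIV = 0"
  shows "(\<Sum>s\<in>UNIV. \<Sum>x\<in>UNIV. g (x - s * k) * g (x - s * l))
         = (if k = l then CARD('a) * (\<Sum>x\<in>UNIV. (g x)\<^sup>2) else 0)"
proof -
  have "(\<Sum>x\<in>UNIV. g (x - s * k) * g (x - s * l)) = (\<Sum>x\<in>UNIV. g x * g (x + s * (k - l)))" for s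
    using sum_UNIV_shift[of "\<lambda>x. g x * g (x + s * (k - l))" "s * k"]
    by (simp add: algebra_simps)
  then have "(\<Sum>s\<in>UNIV. \<Sum>x\<in>UNIV. g (x - s * k) * g (x - s * l))
           = (\<Sum>x\<in>UNIV. g x * (\<Sum>s\<in>UNIV. g (x + s * (k - l))))"
    by (simp only: sum_distrib_left) (rule sum.swap)
  also have "\<dots> = (if k = l then CARD('a) * (\<Sum>x\<in>UNIV. (g x)\<^sup>2) else 0)"
    using assms
    by (cases "k = l") (simp_all add: sum_UNIV_affine sum_distrib_left power2_eq_square mult_ac
        flip: sum_distrib_right)
  finally show ?thesis .
qed

text \<open>
  The left-hand side only depends on the coset \<open>b K\<close>, and summing it over all dilations of \<open>K\<close>
  gives an exact second moment. This replaces the bound \<open>\<surd>q\<close> for Gaussian periods.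
\<close>

lemma convolution_subgroup_bound:
  fixes g :: "'a::{field,finite} \<Rightarrow> real"
  assumes mult: "\<And>x y. x \<in> K \<Longrightarrow> y \<in> K \<Longrightarrow> x * y \<in> K" and "0 \<notin> K" "K \<noteq> {}"
    and g: "sum g UNIV = 0" and "b \<noteq> 0"
  shows "(\<Sum>x\<in>UNIV. (\<Sum>k\<in>K. g (x - b * k))\<^sup>2) \<le> CARD('a) * (\<Sum>x\<in>UNIV. (g x)\<^sup>2)"
proof -
  define P where "P s = (\<Sum>x\<in>UNIV. (\<Sum>k\<in>K. g (x - s * k))\<^sup>2)" for s
  have P_coset: "P (b * k) = P b" if "k \<in> K" for k
  proof -
    \<comment> \<open>Multiplication by \<open>k\<close> is injective on the finite set
      \<open>K\<close> and maps it into itself, so it permutes \<open>K\<close>.\<close>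
    have "k \<noteq> 0" using that \<open>0 \<notin> K\<close> by auto
    then have inj: "inj_on ((*) k) K" by (auto simp: inj_on_def)
    have "(*) k ` K = K"
      by (rule endo_inj_surj) (use inj mult that in auto)
    then have "(\<Sum>y\<in>K. g (x - b * y)) = (\<Sum>y\<in>K. g (x - b * k * y))" for x
      using sum.reindex[OF inj, of "\<lambda>y. g (x - b * y)"] by (simp add: mult.assoc)
    then show ?thesis by (simp add: P_def)
  qed
  \<comment> \<open>The \<open>card K\<close> distinct factors \<open>b * k\<close> all give the
    value \<open>P b\<close>, and each \<open>P s\<close> is non-negative, so
    \<open>card K * P b\<close> is at most the sum of \<open>P\<close> over the field.\<close>
  have "card K * P b = (\<Sum>k\<in>K. P (b * k))" by (simp add: P_coset)
  also have "\<dots> = (\<Sum>s\<in>(*) b ` K. P s)"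
    by (subst sum.reindex) (use \<open>b \<noteq> 0\<close> in \<open>auto simp: inj_on_def\<close>)
  also have "\<dots> \<le> (\<Sum>s\<in>UNIV. P s)"
    by (rule sum_mono2) (auto simp: P_def intro: sum_nonneg)
  also have "\<dots> = (\<Sum>s\<in>UNIV. \<Sum>k\<in>K. \<Sum>l\<in>K. \<Sum>x\<in>UNIV. g (x - s * k) * g (x - s * l))"
    unfolding P_def power2_eq_square sum_product
    by (simp add: sum.swap[of _ UNIV K])
  also have "\<dots> = (\<Sum>k\<in>K. \<Sum>l\<in>K. \<Sum>s\<in>UNIV. \<Sum>x\<in>UNIV. g (x - s * k) * g (x - s * l))"
    by (simp add: sum.swap[of _ UNIV K])
  \<comment> \<open>Only the \<open>card K\<close> diagonal pairs \<open>k = l\<close>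
    survive.\<close>
  also have "\<dots> = card K * (CARD('a) * (\<Sum>x\<in>UNIV. (g x)\<^sup>2))"
    by (simp add: sum_shifted_product[OF g])
  finally show ?thesis
    using \<open>K \<noteq> {}\<close> by (simp add: P_def card_gt_0_iff)
qed

text \<open>The witness \<open>W x\<close> is the number of representations \<open>x = \<Sum> b\<^sub>j y\<^sub>j\<close> with all \<open>y\<^sub>j \<in> K\<close>.\<close>

lemma subgroup_sum_distribution:
  fixes K :: "'a::{field,finite} set"
  assumes mult: "\<And>x y. x \<in> K \<Longrightarrow> y \<in> K \<Longrightarrow> x * y \<in> K" and "0 \<notin> K" "K \<noteq> {}"
    and "finite J" "J \<noteq> {}" "\<forall>j\<in>J. b j \<noteq> 0"
  shows "\<exists>W :: 'a \<Rightarrow> real. sum W UNIV = card K ^ card J \<and>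
           (\<Sum>x\<in>UNIV. (W x - card K ^ card J / CARD('a))\<^sup>2) \<le> card K * CARD('a) ^ (card J - 1) \<and>
           (\<forall>x. W x \<noteq> 0 \<longrightarrow> (\<exists>y. y ` J \<subseteq> K \<and> x = (\<Sum>j\<in>J. b j * y j)))"
  using assms(4-)
proof (induction J rule: finite_ne_induct)
  case (singleton i)
  define W :: "'a \<Rightarrow> real" where "W x = of_bool (x \<in> (*) (b i) ` K)" for x
  define m where "m = real (card K)"
  have "card ((*) (b i) ` K) = card K"
    by (rule card_image) (use singleton in \<open>auto simp: inj_on_def\<close>)
  then have W: "sum W UNIV = m"
    by (simp add: W_def m_def sum.If_cases of_bool_def)
  \<comment> \<open>An indicator function equals its square, so the deviation becomes linear in
    \<open>W\<close>.\<close>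
  have W2: "(W x)\<^sup>2 = W x" for x by (simp add: W_def)
  have "(\<Sum>x\<in>UNIV. (W x - m / CARD('a))\<^sup>2)
      = (\<Sum>x\<in>UNIV. (W x - 2 * (m / CARD('a)) * W x + (m / CARD('a))\<^sup>2))"
    by (simp add: power2_diff W2 algebra_simps)
  also have "\<dots> = m - m\<^sup>2 / CARD('a)"
    unfolding sum.distrib sum_subtractf W sum_distrib_left[symmetric]
    by (simp add: power2_eq_square field_simps)
  also have "\<dots> \<le> m" by simp
  finally have "(\<Sum>x\<in>UNIV. (W x - m / CARD('a))\<^sup>2) \<le> m" .
  moreover have "\<exists>y. y ` {i} \<subseteq> K \<and> x = (\<Sum>j\<in>{i}. b j * y j)" if "W x \<noteq> 0" for x
  proof -
    obtain k where "k \<in> K" "x = b i * k" using \<open>W x \<noteq> 0\<close> by (auto simp: W_def)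
    then show ?thesis by (intro exI[of _ "\<lambda>_. k"]) auto
  qed
  ultimately show ?case using W by (intro exI[of _ W]) (simp add: m_def)
next
  case (insert i J)
  then obtain W :: "'a \<Rightarrow> real" where W: "sum W UNIV = card K ^ card J"
    and dev: "(\<Sum>x\<in>UNIV. (W x - card K ^ card J / CARD('a))\<^sup>2) \<le> card K * CARD('a) ^ (card J - 1)"
    and sol: "\<And>x. W x \<noteq> 0 \<Longrightarrow> (\<exists>y. y ` J \<subseteq> K \<and> x = (\<Sum>j\<in>J. b j * y j))"
    by auto
  define D where "D x = W x - card K ^ card J / CARD('a)" for x
  \<comment> \<open>Splitting off the value \<open>k\<close> taken at \<open>i\<close> makes the new
    count a convolution of the old one with the indicator of \<open>b i\<close> times
    \<open>K\<close>.\<close>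
  define W' where "W' x = (\<Sum>k\<in>K. W (x - b i * k))" for x
  have D: "sum D UNIV = 0" by (simp add: D_def sum_subtractf W)
  have card: "card (insert i J) = Suc (card J)" "card J > 0"
    using insert by (auto simp: card_gt_0_iff)
  have "sum W' UNIV = (\<Sum>k\<in>K. \<Sum>x\<in>UNIV. W (x - b i * k))"
    unfolding W'_def by (rule sum.swap)
  then have "sum W' UNIV = card K ^ card (insert i J)"
    by (simp add: sum_UNIV_shift W card)
  moreover have "(\<Sum>x\<in>UNIV. (W' x - card K ^ card (insert i J) / CARD('a))\<^sup>2)
             \<le> card K * CARD('a) ^ (card (insert i J) - 1)"
  proof -
    \<comment> \<open>The means of \<open>W\<close> add up over \<open>K\<close> to the mean of
      \<open>W'\<close>, so the deviation of \<open>W'\<close> is a convolution of the mean-zero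
      function \<open>D\<close>.\<close>
    have "W' x - card K ^ card (insert i J) / CARD('a) = (\<Sum>k\<in>K. D (x - b i * k))" for x
      by (simp add: W'_def D_def sum_subtractf card)
    then have "(\<Sum>x\<in>UNIV. (W' x - card K ^ card (insert i J) / CARD('a))\<^sup>2)
               \<le> CARD('a) * (\<Sum>x\<in>UNIV. (D x)\<^sup>2)"
      using convolution_subgroup_bound[OF mult \<open>0 \<notin> K\<close> \<open>K \<noteq> {}\<close> D, of "b i"] insert.prems by simp
    also have "\<dots> \<le> CARD('a) * real (card K * CARD('a) ^ (card J - 1))"
      using dev unfolding D_def[symmetric] by (rule mult_left_mono) simp
    also have "\<dots> = card K * CARD('a) ^ (card (insert i J) - 1)"
      using card by (cases "card J") simp_all
    finally show ?thesis .
  qed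
  moreover have "\<exists>y. y ` insert i J \<subseteq> K \<and> x = (\<Sum>j\<in>insert i J. b j * y j)" if nz: "W' x \<noteq> 0" for x
  proof -
    obtain k where k: "k \<in> K" "W (x - b i * k) \<noteq> 0"
      by (rule sum.not_neutral_contains_not_neutral[OF nz[unfolded W'_def]])
    obtain y where y: "y ` J \<subseteq> K" "x - b i * k = (\<Sum>j\<in>J. b j * y j)" using sol[OF k(2)] by auto
    have "(\<Sum>j\<in>J. b j * (y(i := k)) j) = (\<Sum>j\<in>J. b j * y j)"
      using insert.hyps by (intro sum.cong) auto
    then have "x = (\<Sum>j\<in>insert i J. b j * (y(i := k)) j)"
      using insert.hyps y(2) by (simp add: algebra_simps)
    moreover have "(y(i := k)) ` insert i J \<subseteq> K" using y(1) k(1) by auto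
    ultimately show ?thesis by blast
  qed
  ultimately show ?case by (intro exI[of _ W']) auto
qed

text \<open>One index \<open>i\<close> is moved to the other side, so some
  \<open>- (b i * k)\<close> with \<open>k \<in> K\<close> has to be represented by the other
  \<open>n\<close> terms. If none were, each of these \<open>m\<close> points would contribute
  \<open>(m ^ n / q)\<close> squared to a total deviation of at most \<open>m * q ^ (n - 1)\<close>.
  That forces \<open>m ^ (2 * n) \<le> q ^ (n + 1)\<close>, which \<open>large\<close>
  excludes.\<close>

lemma diagonal_equation_solvable:
  fixes K :: "'a::{field,finite} set"
  assumes mult: "\<And>x y. x \<in> K \<Longrightarrow> y \<in> K \<Longrightarrow> x * y \<in> K" and "0 \<notin> K" "K \<noteq> {}"
    and "finite J" "card J \<ge> 2" and b: "\<forall>j\<in>J. b j \<noteq> 0"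
    and large: "card K ^ (2 * (card J - 1)) > CARD('a) ^ card J"
  shows "\<exists>y. y ` J \<subseteq> K \<and> (\<Sum>j\<in>J. b j * y j) = 0"
proof -
  obtain i where "i \<in> J" using \<open>card J \<ge> 2\<close> by fastforce
  define I where "I = J - {i}"
  have I: "finite I" "i \<notin> I" "J = insert i I" "card J = Suc (card I)"
    using \<open>finite J\<close> \<open>i \<in> J\<close> card_Suc_Diff1[of J i] by (auto simp: I_def)
  have "I \<noteq> {}" using I \<open>card J \<ge> 2\<close> by auto
  define m q n where "m = real (card K)" and "q = real CARD('a)" and "n = card I"
  have pos: "m > 0" "q > 0" using \<open>K \<noteq> {}\<close> by (auto simp: m_def q_def card_gt_0_iff)
  have n: "n > 0" using I \<open>I \<noteq> {}\<close> by (auto simp: n_def card_gt_0_iff)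
  obtain W :: "'a \<Rightarrow> real" where
    dev: "(\<Sum>x\<in>UNIV. (W x - m ^ n / q)\<^sup>2) \<le> m * q ^ (n - 1)"
    and sol: "\<And>x. W x \<noteq> 0 \<Longrightarrow> (\<exists>y. y ` I \<subseteq> K \<and> x = (\<Sum>j\<in>I. b j * y j))"
    using subgroup_sum_distribution[OF mult \<open>0 \<notin> K\<close> \<open>K \<noteq> {}\<close> \<open>finite I\<close> \<open>I \<noteq> {}\<close>, of b] b I
    unfolding m_def q_def n_def by auto
  have "\<exists>k\<in>K. W (- (b i * k)) \<noteq> 0"
  proof (rule ccontr)
    assume "\<not> ?thesis"
    then have zero: "W (- (b i * k)) = 0" if "k \<in> K" for k using that by auto
    let ?S = "(\<lambda>k. - (b i * k)) ` K"
    have "card ?S = card K"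
      by (rule card_image) (use b \<open>i \<in> J\<close> in \<open>auto simp: inj_on_def\<close>)
    then have "m * (m ^ n / q)\<^sup>2 = (\<Sum>x\<in>?S. (W x - m ^ n / q)\<^sup>2)"
      using zero by (subst sum.cong[OF refl, of _ _ "\<lambda>_. (m ^ n / q)\<^sup>2"]) (auto simp: m_def)
    also have "\<dots> \<le> (\<Sum>x\<in>UNIV. (W x - m ^ n / q)\<^sup>2)"
      by (rule sum_mono2) auto
    also note dev
    finally have "(m ^ n / q)\<^sup>2 \<le> q ^ (n - 1)" using pos by simp
    then have "(m ^ n)\<^sup>2 \<le> q ^ (n - 1) * q\<^sup>2" using pos by (simp add: field_simps)
    also have "q ^ (n - 1) * q\<^sup>2 = q ^ Suc n" using n by (cases n) (simp_all add: power2_eq_square)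
    finally have "m ^ (2 * n) \<le> q ^ Suc n" by (simp add: power_mult mult.commute)
    then have "real (card K ^ (2 * (card J - 1))) \<le> real (CARD('a) ^ card J)"
      by (simp add: m_def q_def n_def I)
    with large show False by linarith
  qed
  then obtain k where k: "k \<in> K" "W (- (b i * k)) \<noteq> 0" by auto
  obtain y where y: "y ` I \<subseteq> K" "- (b i * k) = (\<Sum>j\<in>I. b j * y j)" using sol[OF k(2)] by auto
  have "(\<Sum>j\<in>I. b j * (y(i := k)) j) = (\<Sum>j\<in>I. b j * y j)"
    using I by (intro sum.cong) auto
  then have "(\<Sum>j\<in>J. b j * (y(i := k)) j) = 0"
    using I y(2)[symmetric] by (simp add: algebra_simps)
  moreover have "(y(i := k)) ` J \<subseteq> K" using y(1) k(1) I by auto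
  ultimately show ?thesis by blast
qed

section \<open>The trace form\<close>

text \<open>Multiplication by \<open>x \<noteq> 0\<close> permutes the non-zero elements; comparing
  their products before and after leaves a power of \<open>x\<close> equal to 1.\<close>

lemma finite_field_power_card:
  fixes x :: "'a::{field,finite}"
  shows "x ^ CARD('a) = x"
proof (cases "x = 0")
  case False
  let ?U = "UNIV - {0::'a}"
  have "(\<Prod>y\<in>?U. y) = (\<Prod>y\<in>?U. x * y)"
    by (rule prod.reindex_bij_witness[where i = "\<lambda>y. x * y" and j = "\<lambda>y. y / x"])
       (use False in auto)
  then have "(\<Prod>y\<in>?U. y) = x ^ card ?U * (\<Prod>y\<in>?U. y)"
    by (simp add: prod.distrib)
  then have "x ^ card ?U = 1" by simp
  moreover have "CARD('a) = Suc (card ?U)" by (simp add: card_Diff_singleton card_gt_0_iff)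
  ultimately show ?thesis by (simp only: power_Suc mult_1_right)
qed (simp add: card_gt_0_iff)

lemma card_field_ge_2: "CARD('a::{field,finite}) \<ge> 2"
  using card_mono[of "UNIV :: 'a set" "{0, 1}"] by simp

text \<open>
  The polynomial \<open>(X + 1) ^ q - X ^ q - 1\<close> has degree less than \<open>q\<close> and vanishes on all of the field.
\<close>

lemma of_nat_card_choose_eq_0:
  assumes "0 < i" "i < CARD('a::{field,finite})"
  shows "of_nat (CARD('a) choose i) = (0::'a)"
proof -
  define q where "q = CARD('a)"
  define p :: "'a poly" where "p = [:1, 1:] ^ q - monom 1 q - 1"
  have coeff: "coeff p j = of_nat (q choose j) - (if j = q then 1 else 0) - (if j = 0 then 1 else 0)"
    if "j \<le> q" for j
    using that by (simp add: p_def coeff_linear_poly_power)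
  have q: "q > 0" by (simp add: q_def card_gt_0_iff)
  have "degree p \<le> q"
    unfolding p_def
    by (intro degree_diff_le degree_monom_le)
       (auto intro: order_trans[OF degree_power_le])
  \<comment> \<open>The leading terms cancel; with degree below \<open>q\<close> and
    \<open>q\<close> roots, \<open>p\<close> must be zero, and its inner coefficients are the
    binomials.\<close>
  moreover have "coeff p q = 0" using q by (simp add: coeff)
  ultimately have deg: "p \<noteq> 0 \<Longrightarrow> degree p < q"
    by (metis le_neq_implies_less leading_coeff_0_iff)
  have "poly p a = 0" for a
    using finite_field_power_card[of a] finite_field_power_card[of "1 + a"]
    by (simp add: p_def poly_monom q_def)
  then have "card {x. poly p x = 0} = q" by (simp add: q_def)
  with deg have "p = 0" using card_poly_roots_bound[of p] by fastforce
  then show ?thesis using coeff[of i] assms by (simp add: q_def)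
qed

text \<open>Independence of an indexed family: unlike for sets, repeated vectors are dependent.\<close>

definition lin_indep :: "('f::field \<Rightarrow> 'e::field) \<Rightarrow> ('i \<Rightarrow> 'e) \<Rightarrow> 'i set \<Rightarrow> bool" where
  "lin_indep \<iota> x J \<longleftrightarrow> (\<forall>a. (\<Sum>j\<in>J. \<iota> (a j) * x j) = 0 \<longrightarrow> (\<forall>j\<in>J. a j = 0))"

lemma lin_indepD: "lin_indep \<iota> x J \<Longrightarrow> (\<Sum>j\<in>J. \<iota> (a j) * x j) = 0 \<Longrightarrow> j \<in> J \<Longrightarrow> a j = 0"
  by (auto simp: lin_indep_def)

text \<open>Dependence of a set attaches coefficients to vectors; along an injective
  \<open>x\<close> they can be carried over to the indices and back.\<close>

lemma independent_image_iff:
  assumes "vector_space s" "finite D" "inj_on x D"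
  shows "\<not> module.dependent s (x ` D) \<longleftrightarrow>
         (\<forall>a. (\<Sum>j\<in>D. s (a j) (x j)) = 0 \<longrightarrow> (\<forall>j\<in>D. a j = 0))"
proof -
  interpret vector_space s by fact
  have sum: "(\<Sum>v\<in>x ` D. s (u v) v) = (\<Sum>j\<in>D. s (u (x j)) (x j))" for u
    using sum.reindex[OF \<open>inj_on x D\<close>] by simp
  have "dependent (x ` D) \<longleftrightarrow> (\<exists>u. (\<exists>j\<in>D. u (x j) \<noteq> 0) \<and> (\<Sum>j\<in>D. s (u (x j)) (x j)) = 0)"
    using \<open>finite D\<close> by (simp add: dependent_finite sum)
  also have "\<dots> \<longleftrightarrow> (\<exists>a. (\<exists>j\<in>D. a j \<noteq> 0) \<and> (\<Sum>j\<in>D. s (a j) (x j)) = 0)"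
  proof safe
    fix a j assume aj: "(\<Sum>j\<in>D. s (a j) (x j)) = 0" "j \<in> D" "a j \<noteq> 0"
    define u where "u = a \<circ> the_inv_into D x"
    have u: "u (x i) = a i" if "i \<in> D" for i
      using \<open>inj_on x D\<close> that by (simp add: u_def the_inv_into_f_f)
    show "\<exists>u. (\<exists>j\<in>D. u (x j) \<noteq> 0) \<and> (\<Sum>j\<in>D. s (u (x j)) (x j)) = 0"
      using aj u by (intro exI[of _ u]) auto
  next
    fix u j assume "(\<Sum>j\<in>D. s (u (x j)) (x j)) = 0" "j \<in> D" "u (x j) \<noteq> 0"
    then show "\<exists>a. (\<exists>j\<in>D. a j \<noteq> 0) \<and> (\<Sum>j\<in>D. s (a j) (x j)) = 0"
      by (intro exI[of _ "u \<circ> x"]) auto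
  qed
  finally show ?thesis by blast
qed

text \<open>Serves both the powers of \<alpha> and the trace sequences: injectivity gives the
  cardinality and turns subsets of the image into sets of exponents.\<close>

lemma is_ks_set_image_iff:
  assumes "vector_space s" "finite C" "inj_on x C" "n \<le> card C"
  shows "is_ks_set s (card C) n (x ` C) \<longleftrightarrow>
         (\<forall>D\<subseteq>C. card D = n \<longrightarrow> (\<forall>a. (\<Sum>j\<in>D. s (a j) (x j)) = 0 \<longrightarrow> (\<forall>j\<in>D. a j = 0)))"
proof -
  have "is_ks_set s (card C) n (x ` C) \<longleftrightarrow>
        (\<forall>D\<subseteq>C. card (x ` D) = n \<longrightarrow> \<not> module.dependent s (x ` D))"
    using assms by (auto simp: is_ks_set_def card_image subset_image_iff)
  also have "\<dots> \<longleftrightarrow> (\<forall>D\<subseteq>C. card D = n \<longrightarrow> (\<forall>a. (\<Sum>j\<in>D. s (a j) (x j)) = 0 \<longrightarrow> (\<forall>j\<in>D. a j = 0)))"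
  proof (rule all_cong1, rule imp_cong[OF refl])
    fix D assume "D \<subseteq> C"
    then have D: "finite D" "inj_on x D"
      using assms by (auto intro: finite_subset inj_on_subset)
    show "(card (x ` D) = n \<longrightarrow> \<not> module.dependent s (x ` D)) \<longleftrightarrow>
          (card D = n \<longrightarrow> (\<forall>a. (\<Sum>j\<in>D. s (a j) (x j)) = 0 \<longrightarrow> (\<forall>j\<in>D. a j = 0)))"
      using D by (simp add: card_image independent_image_iff[OF assms(1) D])
  qed
  finally show ?thesis .
qed

lemma sum_fun_apply: "sum f A i = (\<Sum>j\<in>A. f j i)"
  by (induction A rule: infinite_finite_induct) simp_all

lemma lin_indep_reindex:
  assumes "inj_on h I"
  shows "lin_indep \<iota> (\<lambda>i. x (h i)) I \<longleftrightarrow> lin_indep \<iota> x (h ` I)"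
proof
  assume indep: "lin_indep \<iota> (\<lambda>i. x (h i)) I"
  show "lin_indep \<iota> x (h ` I)"
    unfolding lin_indep_def
  proof (intro allI impI)
    fix a assume "(\<Sum>j\<in>h ` I. \<iota> (a j) * x j) = 0"
    then have "(\<Sum>i\<in>I. \<iota> (a (h i)) * x (h i)) = 0" using assms by (simp add: sum.reindex)
    then show "\<forall>j\<in>h ` I. a j = 0" using lin_indepD[OF indep, of "\<lambda>i. a (h i)"] by blast
  qed
next
  assume indep: "lin_indep \<iota> x (h ` I)"
  show "lin_indep \<iota> (\<lambda>i. x (h i)) I"
    unfolding lin_indep_def
  proof (intro allI impI ballI)
    fix a i assume sum: "(\<Sum>i\<in>I. \<iota> (a i) * x (h i)) = 0" and "i \<in> I"
    have inv: "the_inv_into I h (h i) = i" if "i \<in> I" for i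
      using assms that by (rule the_inv_into_f_f)
    have "(\<Sum>j\<in>h ` I. \<iota> (a (the_inv_into I h j)) * x j) = 0"
      using assms sum inv by (simp add: sum.reindex)
    from lin_indepD[OF indep this, of "h i"] show "a i = 0" using \<open>i \<in> I\<close> inv by simp
  qed
qed

section \<open>The field extension and its Frobenius map\<close>

locale finite_field_extension =
  fixes \<iota> :: "'f::{field,finite} \<Rightarrow> 'e::{field,finite}" and q t :: nat
  assumes emb: "field_embedding \<iota>"
    and card_base: "CARD('f) = q"
    and card_ext: "CARD('e) = q ^ t"
begin

lemma emb_1 [simp]: "\<iota> 1 = 1" and emb_add: "\<iota> (a + b) = \<iota> a + \<iota> b"
  and emb_mult: "\<iota> (a * b) = \<iota> a * \<iota> b"
  using emb by (auto simp: field_embedding_def)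

lemma emb_0 [simp]: "\<iota> 0 = 0"
  using emb_add[of 0 0] by (metis add.right_neutral add_left_cancel)

lemma emb_minus: "\<iota> (- a) = - \<iota> a"
  using emb_add[of a "- a"] by (simp add: eq_neg_iff_add_eq_0 add.commute)

lemma emb_diff: "\<iota> (a - b) = \<iota> a - \<iota> b"
  using emb_add[of a "- b"] by (simp add: emb_minus)

lemma emb_eq_0_iff [simp]: "\<iota> a = 0 \<longleftrightarrow> a = 0"
proof
  assume "\<iota> a = 0"
  show "a = 0"
  proof (rule ccontr)
    assume "a \<noteq> 0"
    then have "\<iota> (a * inverse a) = 1" by simp
    with \<open>\<iota> a = 0\<close> show False by (simp only: emb_mult) simp
  qed
qed simp

lemma emb_inj: "inj \<iota>"
  by (rule injI) (metis emb_diff emb_eq_0_iff right_minus_eq)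

lemma emb_eq_iff [simp]: "\<iota> a = \<iota> b \<longleftrightarrow> a = b"
  using emb_inj by (simp add: inj_eq)

lemma emb_power: "\<iota> (a ^ n) = \<iota> a ^ n"
  by (induction n) (simp_all add: emb_mult)

lemma emb_of_nat: "\<iota> (of_nat n) = of_nat n"
  by (induction n) (simp_all add: emb_add)

lemma q_ge_2: "q \<ge> 2"
  using card_field_ge_2[where 'a = 'f] by (simp add: card_base)

lemma t_pos: "t > 0"
  using card_ext card_field_ge_2[where 'a = 'e] by (cases t) auto

lemma emb_power_q: "\<iota> a ^ q = \<iota> a"
  using finite_field_power_card[of a] by (simp add: card_base flip: emb_power)

lemma emb_power_q_power: "\<iota> a ^ (q ^ i) = \<iota> a"
  by (induction i) (simp_all add: power_mult emb_power_q)

text \<open>The inner binomial coefficients vanish in the small field, and \<iota> carries this over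
  to the large one.\<close>

lemma power_q_add: "(x + y) ^ q = x ^ q + y ^ q" for x y :: 'e
proof -
  have "of_nat (q choose i) = (0::'e)" if "i \<in> {0<..<q}" for i
    using that of_nat_card_choose_eq_0[of i, where 'a = 'f] emb_of_nat[of "q choose i"]
    by (simp add: card_base)
  then have "(\<Sum>i\<in>{0<..<q}. of_nat (q choose i) * x ^ i * y ^ (q - i)) = 0"
    by (intro sum.neutral) auto
  moreover have "{..q} = insert 0 (insert q {0<..<q})" using q_ge_2 by auto
  ultimately show ?thesis
    using q_ge_2 by (simp add: binomial_ring add.commute)
qed

lemma power_q_power_add: "(x + y) ^ (q ^ i) = x ^ (q ^ i) + y ^ (q ^ i)" for x y :: 'e
  by (induction i) (simp_all add: power_mult power_q_add power_Suc2 del: power_Suc)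

lemma power_q_sum: "(\<Sum>i\<in>A. f i) ^ q = (\<Sum>i\<in>A. f i ^ q)" for f :: "'i \<Rightarrow> 'e"
  using q_ge_2 by (induction A rule: infinite_finite_induct) (simp_all add: power_q_add)

text \<open>The image already supplies \<open>q\<close> roots of \<open>X ^ q - X\<close>, which has
  no more.\<close>

lemma range_emb: "range \<iota> = {y. y ^ q = y}"
proof (rule card_subset_eq)
  define p :: "'e poly" where "p = monom 1 q - monom 1 1"
  have roots: "{y. poly p y = 0} = {y. y ^ q = y}" by (simp add: p_def poly_monom)
  have "coeff p q = 1" using q_ge_2 by (simp add: p_def)
  then have "p \<noteq> 0" by auto
  then have "card {y::'e. y ^ q = y} \<le> degree p"
    using card_poly_roots_bound[of p] roots by simp
  also have "degree p \<le> q"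
    unfolding p_def
    by (intro degree_diff_le order_trans[OF degree_monom_le]) (use q_ge_2 in auto)
  finally have "card {y::'e. y ^ q = y} \<le> q" .
  moreover have sub: "range \<iota> \<subseteq> {y. y ^ q = y}" by (auto simp: emb_power_q)
  moreover have "card (range \<iota>) = q" by (simp add: card_image[OF emb_inj] card_base)
  ultimately show "card (range \<iota>) = card {y::'e. y ^ q = y}"
    using card_mono[OF _ sub] by simp
  show "range \<iota> \<subseteq> {y. y ^ q = y}" by (rule sub)
qed simp

section \<open>The trace and its non-degeneracy\<close>

abbreviation T :: "'e \<Rightarrow> 'f" where "T \<equiv> Tr \<iota> t"

text \<open>Raising to the power \<open>q\<close> shifts the conjugates of \<open>x\<close>
  cyclically, because \<open>x ^ (q ^ t) = x\<close>. The sum is therefore fixed, lies in the range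
  of \<iota>, and \<open>inv \<iota>\<close> is a true preimage.\<close>

lemma emb_trace: "\<iota> (T x) = (\<Sum>i<t. x ^ (q ^ i))"
proof -
  define f where "f i = x ^ (q ^ i)" for i
  have "(\<Sum>i<t. f i) ^ q = (\<Sum>i<t. f (Suc i))"
    by (simp add: power_q_sum f_def power_mult power_Suc2 del: power_Suc)
  moreover have "f t = x" using finite_field_power_card[of x] by (simp add: f_def card_ext)
  then have "(\<Sum>i<t. f (Suc i)) = (\<Sum>i<t. f i)"
    using sum.lessThan_Suc_shift[of f t] by (simp add: f_def)
  ultimately have "(\<Sum>i<t. f i) \<in> range \<iota>" by (simp add: range_emb)
  then show ?thesis by (simp add: Tr_def f_def f_inv_into_f card_base)
qed

lemma trace_add: "T (x + y) = T x + T y"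
  by (subst emb_eq_iff[symmetric]) (simp only: emb_add emb_trace power_q_power_add sum.distrib)

lemma trace_scale: "T (\<iota> a * x) = a * T x"
  by (subst emb_eq_iff[symmetric])
     (simp add: emb_mult emb_trace power_mult_distrib emb_power_q_power sum_distrib_left)

lemma trace_scale_right: "T (x * (\<iota> a * y)) = a * T (x * y)"
  using trace_scale[of a "x * y"] by (simp add: mult_ac)

lemma trace_0 [simp]: "T 0 = 0"
  using trace_scale[of 0 0] by simp

lemma trace_diff: "T (x - y) = T x - T y"
  using trace_add[of "x - y" y] by simp

lemma trace_sum: "T (sum f A) = (\<Sum>i\<in>A. T (f i))"
  by (induction A rule: infinite_finite_induct) (simp_all add: trace_add)

text \<open>The trace is given by a non-zero polynomial of degree at most
  \<open>q ^ (t - 1)\<close>, too small to vanish on \<open>q ^ t\<close> elements. A non-zero value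
  can then be rescaled to \<open>c\<close> by the small field.\<close>

lemma trace_surj_at:
  assumes "x \<noteq> 0"
  shows "\<exists>z. T (z * x) = c"
proof -
  define p :: "'e poly" where "p = (\<Sum>i<t. monom 1 (q ^ i))"
  \<comment> \<open>Only the summand \<open>i = 0\<close> has exponent
    \<open>q ^ i = 1\<close>.\<close>
  have "coeff p 1 = (\<Sum>i<t. if i = 0 then 1 else 0)"
    unfolding p_def coeff_sum
    by (rule sum.cong) (use q_ge_2 in auto)
  then have "p \<noteq> 0" using t_pos by auto
  have "degree p \<le> q ^ (t - 1)"
    unfolding p_def
    by (intro degree_sum_le order_trans[OF degree_monom_le] power_increasing) (use q_ge_2 in auto)
  also have "\<dots> < q ^ t" using q_ge_2 t_pos by (intro power_strict_increasing) auto
  finally have "card {y. poly p y = 0} < CARD('e)"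
    using card_poly_roots_bound[OF \<open>p \<noteq> 0\<close>] card_ext by simp
  then have "{y. poly p y = 0} \<noteq> UNIV" by force
  then obtain y where "poly p y \<noteq> 0" by auto
  then have "\<iota> (T y) \<noteq> 0" by (simp add: emb_trace p_def poly_sum poly_monom)
  then have "T (\<iota> (c / T y) * y) = c" by (simp add: trace_scale)
  then show ?thesis using assms by (intro exI[of _ "\<iota> (c / T y) * y / x"]) simp
qed

section \<open>Dual families and fibres of the trace pairing\<close>

lemma lin_indep_subset:
  assumes "lin_indep \<iota> x J" "I \<subseteq> J" "finite J"
  shows "lin_indep \<iota> x I"
  unfolding lin_indep_def
proof (intro allI impI ballI)
  fix a i assume zero: "(\<Sum>j\<in>I. \<iota> (a j) * x j) = 0" and "i \<in> I"
  have "(\<Sum>j\<in>J. \<iota> (if j \<in> I then a j else 0) * x j) = (\<Sum>j\<in>I. \<iota> (a j) * x j)"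
    using assms by (intro sum.mono_neutral_cong_right) auto
  then show "a i = 0"
    using lin_indepD[OF assms(1), of "\<lambda>j. if j \<in> I then a j else 0" i] zero \<open>i \<in> I\<close> \<open>I \<subseteq> J\<close> by auto
qed

text \<open>A Gram-Schmidt step: \<open>y\<close> is \<open>x n\<close> reduced modulo the earlier
  vectors and is non-zero by independence. Some \<open>w\<close> pairs with it to 1, and
  \<open>u\<close> is \<open>w\<close> made orthogonal to all earlier vectors.\<close>

lemma trace_dual:
  assumes "finite J" "lin_indep \<iota> x J"
  shows "\<exists>z. \<forall>i\<in>J. \<forall>j\<in>J. T (z i * x j) = (if i = j then 1 else 0)"
  using assms
proof (induction J)
  case (insert n J)
  then have "lin_indep \<iota> x J" using lin_indep_subset[of x "insert n J" J] by auto
  then obtain z where z: "\<And>i j. i \<in> J \<Longrightarrow> j \<in> J \<Longrightarrow> T (z i * x j) = (if i = j then 1 else 0)"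
    using insert.IH by auto
  define y where "y = x n - (\<Sum>i\<in>J. \<iota> (T (z i * x n)) * x i)"
  have "y \<noteq> 0"
  proof
    assume "y = 0"
    let ?a = "\<lambda>i. if i = n then 1 else - T (z i * x n)"
    have "(\<Sum>i\<in>J. \<iota> (?a i) * x i) = (\<Sum>i\<in>J. - (\<iota> (T (z i * x n)) * x i))"
      using insert.hyps by (intro sum.cong) (auto simp: emb_minus)
    then have "(\<Sum>i\<in>insert n J. \<iota> (?a i) * x i) = 0"
      using insert.hyps \<open>y = 0\<close> by (simp add: y_def sum_negf)
    then have "?a n = 0"
      by (rule lin_indepD[OF insert.prems]) simp
    then show False by simp
  qed
  then obtain w where w: "T (w * y) = 1" using trace_surj_at by blast
  define u where "u = w - (\<Sum>i\<in>J. \<iota> (T (w * x i)) * z i)"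
  have uJ: "T (u * x j) = 0" if "j \<in> J" for j
  proof -
    have "T (u * x j) = T (w * x j) - (\<Sum>i\<in>J. T (w * x i) * T (z i * x j))"
      by (simp add: u_def left_diff_distrib sum_distrib_right trace_diff trace_sum trace_scale mult.assoc)
    also have "(\<Sum>i\<in>J. T (w * x i) * T (z i * x j)) = T (w * x j)"
      using insert.hyps that by (simp add: z if_distrib[of "\<lambda>c. _ * c"] cong: if_cong)
    finally show ?thesis by simp
  qed
  \<comment> \<open>The corrections in \<open>u\<close> and in \<open>y\<close> contribute the same
    sum, so the pairing of \<open>u\<close> with \<open>x n\<close> equals that of \<open>w\<close>
    with \<open>y\<close>.\<close>
  have un: "T (u * x n) = 1"
  proof -
    have "T (w * y) = T (w * x n) - (\<Sum>i\<in>J. T (z i * x n) * T (w * x i))"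
      by (simp add: y_def right_diff_distrib sum_distrib_left trace_diff trace_sum trace_scale_right)
    moreover have "T (u * x n) = T (w * x n) - (\<Sum>i\<in>J. T (w * x i) * T (z i * x n))"
      by (simp add: u_def left_diff_distrib sum_distrib_right trace_diff trace_sum trace_scale
          mult.assoc)
    ultimately show ?thesis using w by (simp add: mult.commute)
  qed
  \<comment> \<open>The earlier dual elements are corrected by a multiple of \<open>u\<close> to
    become orthogonal to \<open>x n\<close>.\<close>
  define z' where "z' i = (if i = n then u else z i - \<iota> (T (z i * x n)) * u)" for i
  have "T (z' i * x j) = (if i = j then 1 else 0)" if "i \<in> insert n J" "j \<in> insert n J" for i j
    using that insert.hyps
    by (auto simp: z'_def uJ un z left_diff_distrib trace_diff trace_scale mult.assoc)
  then show ?case by blast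
qed simp

lemma trace_interpolation:
  assumes "finite J" "lin_indep \<iota> x J"
  shows "\<exists>z. \<forall>j\<in>J. T (z * x j) = f j"
proof -
  obtain z where z: "\<And>i j. i \<in> J \<Longrightarrow> j \<in> J \<Longrightarrow> T (z i * x j) = (if i = j then 1 else 0)"
    using trace_dual[OF assms] by blast
  have "T ((\<Sum>i\<in>J. \<iota> (f i) * z i) * x j) = f j" if "j \<in> J" for j
    using that assms(1)
    by (simp add: sum_distrib_right trace_sum trace_scale mult.assoc z
        if_distrib[of "\<lambda>c. _ * c"] cong: if_cong)
  then show ?thesis by blast
qed

text \<open>By interpolation the \<open>q ^ card J\<close> fibres are all non-empty translates of
  one another, and they partition the \<open>q ^ t\<close> elements of the field.\<close>

lemma trace_fibre_card:
  fixes x :: "'i \<Rightarrow> 'e"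
  assumes "finite J" "lin_indep \<iota> x J"
  shows "card {z. \<forall>j\<in>J. T (z * x j) = f j} * q ^ card J = q ^ t"
proof -
  define S where "S g = {z. \<forall>j\<in>J. T (z * x j) = g j}" for g
  have S_card: "card (S g) = card (S f)" for g
  proof -
    obtain z where z: "\<And>j. j \<in> J \<Longrightarrow> T (z * x j) = f j - g j"
      using trace_interpolation[OF assms, of "\<lambda>j. f j - g j"] by auto
    have "bij_betw (\<lambda>y. y + z) (S g) (S f)"
      by (rule bij_betw_byWitness[where f' = "\<lambda>y. y - z"])
         (auto simp: S_def z left_diff_distrib distrib_right trace_add trace_diff)
    then show ?thesis by (rule bij_betw_same_card)
  qed
  have "(\<Union>g\<in>J \<rightarrow>\<^sub>E UNIV. S g) = UNIV"
  proof (rule equalityI[OF subset_UNIV], rule subsetI)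
    fix z :: 'e
    show "z \<in> (\<Union>g\<in>J \<rightarrow>\<^sub>E UNIV. S g)"
      by (rule UN_I[of "restrict (\<lambda>j. T (z * x j)) J"]) (auto simp: S_def)
  qed
  then have "q ^ t = card (\<Union>g\<in>J \<rightarrow>\<^sub>E UNIV. S g)" by (simp add: card_ext)
  also have "\<dots> = (\<Sum>g\<in>J \<rightarrow>\<^sub>E UNIV. card (S g))"
  proof (rule card_UN_disjoint)
    show "\<forall>g\<in>J \<rightarrow>\<^sub>E UNIV. \<forall>h\<in>J \<rightarrow>\<^sub>E UNIV. g \<noteq> h \<longrightarrow> S g \<inter> S h = {}"
    proof (intro ballI impI)
      fix g h :: "'i \<Rightarrow> 'f" assume "g \<in> J \<rightarrow>\<^sub>E UNIV" "h \<in> J \<rightarrow>\<^sub>E UNIV" "g \<noteq> h"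
      then obtain j where "j \<in> J" "g j \<noteq> h j" by (meson PiE_ext)
      then show "S g \<inter> S h = {}" by (auto simp: S_def)
    qed
  qed (use assms in \<open>auto intro: finite_PiE\<close>)
  also have "\<dots> = (\<Sum>g\<in>J \<rightarrow>\<^sub>E (UNIV :: 'f set). card (S f))"
    by (rule sum.cong[OF refl S_card])
  also have "\<dots> = q ^ card J * card (S f)"
    using assms by (simp add: card_PiE card_base)
  finally show ?thesis by (simp add: S_def mult.commute)
qed

section \<open>Evaluation of polynomials and the minimal polynomial\<close>

lemma eval_pCons: "poly (map_poly \<iota> (pCons a r)) x = \<iota> a + x * poly (map_poly \<iota> r) x"
  by (simp add: map_poly_pCons)

lemma eval_add: "poly (map_poly \<iota> (r + s)) x = poly (map_poly \<iota> r) x + poly (map_poly \<iota> s) x"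
proof -
  have "map_poly \<iota> (r + s) = map_poly \<iota> r + map_poly \<iota> s"
    by (rule poly_eqI) (simp add: coeff_map_poly emb_add)
  then show ?thesis by simp
qed

lemma eval_diff: "poly (map_poly \<iota> (r - s)) x = poly (map_poly \<iota> r) x - poly (map_poly \<iota> s) x"
  using eval_add[of "r - s" s x] by simp

lemma eval_smult: "poly (map_poly \<iota> (smult a r)) x = \<iota> a * poly (map_poly \<iota> r) x"
  by (induction r) (simp_all add: eval_pCons emb_mult algebra_simps)

lemma eval_mult: "poly (map_poly \<iota> (r * s)) x = poly (map_poly \<iota> r) x * poly (map_poly \<iota> s) x"
  by (induction r) (simp_all add: eval_pCons eval_add eval_smult algebra_simps)

lemma eval_monom: "poly (map_poly \<iota> (monom a n)) x = \<iota> a * x ^ n"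
  by (simp add: map_poly_monom poly_monom)

lemma eval_sum: "poly (map_poly \<iota> (sum f A)) x = (\<Sum>i\<in>A. poly (map_poly \<iota> (f i)) x)"
  by (induction A rule: infinite_finite_induct) (simp_all add: eval_add)

text \<open>The description in \<open>min_poly\<close> is first shown to have a unique solution: two
  monic annihilators of least degree differ by one of smaller degree, hence by zero. Divisibility
  then follows from division with remainder.\<close>

lemma min_poly_dvd_iff: "min_poly \<iota> x dvd r \<longleftrightarrow> poly (map_poly \<iota> r) x = 0"
proof -
  let ?ev = "\<lambda>r. poly (map_poly \<iota> r) x"
  define P where "P p \<longleftrightarrow> lead_coeff p = 1 \<and> ?ev p = 0 \<and> (\<forall>r. r \<noteq> 0 \<and> ?ev r = 0 \<longrightarrow> degree p \<le> degree r)"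
    for p
  have "\<exists>p. P p"
  proof -
    \<comment> \<open>\<open>X ^ (q ^ t) - X\<close> annihilates every element of the large field,
      so annihilators of least degree exist.\<close>
    define s :: "'f poly" where "s = monom 1 (q ^ t) - monom 1 1"
    have "coeff s 1 = -1" using q_ge_2 t_pos by (simp add: s_def)
    then have "s \<noteq> 0" by auto
    moreover have "?ev s = 0"
      using finite_field_power_card[of x] by (simp add: s_def eval_diff eval_monom card_ext)
    ultimately have "s \<noteq> 0 \<and> ?ev s = 0" by simp
    from ex_has_least_nat[of "\<lambda>s. s \<noteq> 0 \<and> ?ev s = 0", OF this, of degree]
    obtain p where p: "p \<noteq> 0" "?ev p = 0" "\<And>r. r \<noteq> 0 \<and> ?ev r = 0 \<Longrightarrow> degree p \<le> degree r"
      by auto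
    have "P (smult (inverse (lead_coeff p)) p)"
      using p by (simp add: P_def eval_smult)
    then show ?thesis by blast
  qed
  moreover have "p = p'" if "P p" "P p'" for p p'
  proof (rule ccontr)
    assume "p \<noteq> p'"
    have deg: "degree p = degree p'" using that unfolding P_def by (metis leading_coeff_0_iff order_antisym zero_neq_one)
    have "?ev (p - p') = 0" using that by (simp add: P_def eval_diff)
    then have "degree p \<le> degree (p - p')" using \<open>p \<noteq> p'\<close> \<open>P p\<close> by (simp add: P_def)
    moreover have "degree (p - p') \<le> degree p" using deg by (simp add: degree_diff_le)
    ultimately have "lead_coeff (p - p') = 0" using deg that by (simp add: P_def)
    then have "p - p' = 0" by (simp only: leading_coeff_0_iff)
    then show False using \<open>p \<noteq> p'\<close> by simp
  qed
  ultimately have "P (THE p. P p)" by (blast intro: theI)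
  then have "P (min_poly \<iota> x)" by (simp add: min_poly_def P_def)
  then have m: "min_poly \<iota> x \<noteq> 0" "?ev (min_poly \<iota> x) = 0"
    "\<And>r. r \<noteq> 0 \<Longrightarrow> ?ev r = 0 \<Longrightarrow> degree (min_poly \<iota> x) \<le> degree r"
    by (auto simp: P_def)
  show ?thesis
  proof
    assume "?ev r = 0"
    moreover have "?ev r = ?ev (r div min_poly \<iota> x * min_poly \<iota> x + r mod min_poly \<iota> x)"
      by (simp only: div_mult_mod_eq)
    ultimately have "?ev (r mod min_poly \<iota> x) = 0"
      using m(2) by (simp only: eval_add eval_mult) simp
    then show "min_poly \<iota> x dvd r"
      using m(3) degree_mod_less[OF m(1), of r] by (auto simp: mod_eq_0_iff_dvd not_le[symmetric])
  qed (auto simp: dvd_def eval_mult m(2))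
qed

section \<open>Dimension and flats\<close>

text \<open>By non-degeneracy only 0 pairs to zero with a whole spanning set. The zero fibre of an
  independent one is thus a single point, and the fibre count gives
  \<open>q ^ card B = q ^ t\<close>.\<close>

lemma card_basis:
  assumes "\<not> module.dependent (ext_scale \<iota>) B" "module.span (ext_scale \<iota>) B = UNIV"
  shows "card B = t"
proof -
  interpret V: vector_space "ext_scale \<iota>" by (rule vector_space_ext_scale[OF emb])
  have "lin_indep \<iota> (\<lambda>b. b) B"
    using assms(1) independent_image_iff[OF vector_space_ext_scale[OF emb], of B "\<lambda>b. b"]
    by (simp add: lin_indep_def ext_scale_def)
  moreover have "{z. \<forall>b\<in>B. T (z * b) = 0} = {0}"
  proof -
    have "z = 0" if z: "\<forall>b\<in>B. T (z * b) = 0" for z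
    proof (rule ccontr)
      assume "z \<noteq> 0"
      then obtain y where y: "T (y * z) = 1" using trace_surj_at by blast
      have "V.subspace {y. T (z * y) = 0}"
        by (simp add: V.subspace_def ext_scale_def distrib_left trace_add trace_scale_right)
      with z have "V.span B \<subseteq> {y. T (z * y) = 0}" by (intro V.span_minimal) auto
      then have "T (z * y) = 0" using assms(2) by blast
      then show False using y by (simp add: mult.commute)
    qed
    then show ?thesis by auto
  qed
  ultimately have "q ^ card B = q ^ t"
    using trace_fibre_card[of B "\<lambda>b. b" "\<lambda>_. 0"] by simp
  then show ?thesis using q_ge_2 by (simp add: power_inject_exp)
qed

text \<open>A dependent set of \<open>t - 1\<close> vectors spans at most \<open>t - 2\<close>
  dimensions, and a space of dimension \<open>t - 2\<close> has no room for \<open>t - 1\<close>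
  independent vectors. \<open>point_in_iff\<close> passes from points to vectors.\<close>

lemma dependent_iff_in_flat:
  assumes X: "finite X" "card X = t - 1" "0 \<notin> X" and t: "t \<ge> 2"
  shows "module.dependent (ext_scale \<iota>) X \<longleftrightarrow>
         (\<exists>F. is_flat \<iota> (int t - 3) F \<and> proj_point \<iota> ` X \<subseteq> F)"
proof -
  interpret V: vector_space "ext_scale \<iota>" by (rule vector_space_ext_scale[OF emb])
  have point_in_iff: "proj_point \<iota> ` X \<subseteq> proj_point \<iota> ` (S - {0}) \<longleftrightarrow> X \<subseteq> S"
    if S: "V.subspace S" for S
  proof
    assume sub: "proj_point \<iota> ` X \<subseteq> proj_point \<iota> ` (S - {0})"
    show "X \<subseteq> S"
    proof
      fix x assume "x \<in> X"
      then obtain s where "s \<in> S" "V.span {x} = V.span {s}"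
        using sub by (auto simp: proj_point_def)
      then have "x \<in> V.span {s}" using V.span_base[of x "{x}"] by simp
      also have "\<dots> \<subseteq> S" using \<open>s \<in> S\<close> S by (intro V.span_minimal) auto
      finally show "x \<in> S" .
    qed
  next
    assume "X \<subseteq> S"
    then show "proj_point \<iota> ` X \<subseteq> proj_point \<iota> ` (S - {0})" using X by (intro image_mono) auto
  qed
  have "V.dependent X \<longleftrightarrow> (\<exists>S. V.subspace S \<and> V.dim S = t - 2 \<and> X \<subseteq> S)"
  proof
    assume dep: "V.dependent X"
    obtain B where B: "B \<subseteq> X" "V.independent B" "X \<subseteq> V.span B"
      using V.maximal_independent_subset by blast
    have "B \<noteq> X" using B dep by auto
    then have "card B < card X" using X B by (intro psubset_card_mono) auto
    then have "card B \<le> t - 2" using X by simp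
    obtain B' where B': "B \<subseteq> B'" "V.independent B'" "UNIV \<subseteq> V.span B'"
      using V.maximal_independent_subset_extend[of B UNIV] B by auto
    have "card B' = t" using B' by (intro card_basis) auto
    \<comment> \<open>A flat has an exact dimension, so \<open>B\<close> is enlarged inside a basis
      of the whole field to exactly \<open>t - 2\<close> vectors.\<close>
    obtain A where A: "B \<subseteq> A" "A \<subseteq> B'" "card A = t - 2"
      using exists_subset_between[of B "t - 2" B'] \<open>card B \<le> t - 2\<close> \<open>card B' = t\<close> B' by auto
    have "V.dim (V.span A) = t - 2"
      using A B' by (metis V.dim_span_eq_card_independent V.independent_mono)
    moreover have "X \<subseteq> V.span A" using B A V.span_mono by blast
    ultimately show "\<exists>S. V.subspace S \<and> V.dim S = t - 2 \<and> X \<subseteq> S"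
      using V.subspace_span by blast
  next
    assume "\<exists>S. V.subspace S \<and> V.dim S = t - 2 \<and> X \<subseteq> S"
    then obtain S where S: "V.dim S = t - 2" "X \<subseteq> S" by blast
    obtain B where B: "S \<subseteq> V.span B" "card B = t - 2"
      using V.basis_exists[of S] S by metis
    show "V.dependent X"
    proof (rule ccontr)
      assume "V.independent X"
      then have "card X \<le> card B"
        using V.independent_span_bound[of B X] B S by auto
      then show False using B X t by simp
    qed
  qed
  also have "\<dots> \<longleftrightarrow> (\<exists>F. is_flat \<iota> (int t - 3) F \<and> proj_point \<iota> ` X \<subseteq> F)"
  proof -
    \<comment> \<open>For \<open>t = 2\<close> the flat has dimension -1 and \<open>S\<close> has
      dimension 0.\<close>
    have "int (V.dim S) = int t - 3 + 1 \<longleftrightarrow> V.dim S = t - 2" for S using t by linarith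
    then show ?thesis unfolding is_flat_def by (metis point_in_iff)
  qed
  finally show ?thesis .
qed

end

section \<open>Equivalence of the conditions\<close>

locale primitive_extension = finite_field_extension +
  fixes \<alpha> :: 'b
  assumes prim: "primitive_element \<alpha>" and t_ge_2: "t \<ge> 2"
begin

text \<open>The multiplicative order of \<alpha>.\<close>

definition "N = q ^ t - 1"

lemma N_pos: "N > 0" and q_power_t: "q ^ t = Suc N"
  using power_strict_mono[of 1 q t] q_ge_2 t_ge_2 by (auto simp: N_def)

lemma prim_nonzero [simp]: "\<alpha> \<noteq> 0"
proof
  assume "\<alpha> = 0"
  have "\<alpha> ^ 1 \<in> range (\<lambda>n::nat. \<alpha> ^ n)" by blast
  then show False using prim \<open>\<alpha> = 0\<close> by (simp add: primitive_element_def)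
qed

lemma prim_power_N: "\<alpha> ^ N = 1"
  using finite_field_power_card[of \<alpha>] by (simp add: card_ext q_power_t)

lemma prim_power_mod: "\<alpha> ^ (i mod N) = \<alpha> ^ i"
proof -
  have "\<alpha> ^ i = \<alpha> ^ (N * (i div N) + i mod N)" by simp
  also have "\<dots> = \<alpha> ^ (i mod N)" by (simp only: power_add power_mult prim_power_N) simp
  finally show ?thesis by simp
qed

lemma prim_power_image: "(\<lambda>i. \<alpha> ^ i) ` {..<N} = UNIV - {0}"
proof -
  have "range (\<lambda>i. \<alpha> ^ i) \<subseteq> (\<lambda>i. \<alpha> ^ i) ` {..<N}"
    using N_pos prim_power_mod by (metis (no_types, lifting) image_subsetI imageI lessThan_iff mod_less_divisor)
  then show ?thesis using prim by (auto simp: primitive_element_def)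
qed

lemma prim_power_inj: "inj_on (\<lambda>i. \<alpha> ^ i) {..<N}"
  by (rule eq_card_imp_inj_on) (simp_all add: prim_power_image card_Diff_singleton card_ext q_power_t)

lemma prim_powerE:
  assumes "z \<noteq> 0"
  obtains i where "i < N" "z = \<alpha> ^ i"
  using assms prim_power_image by (metis Diff_iff UNIV_I empty_iff imageE insert_iff lessThan_iff)

lemma trace_powers_eq_0:
  assumes "\<And>i. i < N \<Longrightarrow> T (\<alpha> ^ i * y) = 0"
  shows "y = 0"
proof (rule ccontr)
  assume "y \<noteq> 0"
  then obtain z where z: "T (z * y) = 1" using trace_surj_at by blast
  then have "z \<noteq> 0" by auto
  then show False using z assms by (metis prim_powerE zero_neq_one)
qed

end

section \<open>Reduction of each condition to independence of subsets\<close>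

locale exponent_list = primitive_extension +
  fixes cs :: "nat list"
  assumes distinct_cs: "distinct cs" and cs_less: "set cs \<subseteq> {..<N}"
    and length_cs: "t - 1 \<le> length cs"
begin

text \<open>The common form to which all the conditions are reduced.\<close>

definition subsets_indep :: bool where
  "subsets_indep \<longleftrightarrow> (\<forall>D\<subseteq>set cs. card D = t - 1 \<longrightarrow> lin_indep \<iota> (\<lambda>c. \<alpha> ^ c) D)"

lemma card_cs: "card (set cs) = length cs"
  by (rule distinct_card[OF distinct_cs])

lemma power_inj_cs: "inj_on (\<lambda>c. \<alpha> ^ c) (set cs)"
  by (rule inj_on_subset[OF prim_power_inj cs_less])

lemma power_set_condition_iff: "power_set_condition \<iota> t \<alpha> cs \<longleftrightarrow> subsets_indep"
  using is_ks_set_image_iff[OF vector_space_ext_scale[OF emb] finite_set power_inj_cs, of "t - 1"]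
    length_cs
  by (simp add: power_set_condition_def card_cs subsets_indep_def lin_indep_def ext_scale_def)

text \<open>Entry \<open>i\<close> of a combination of sequences is the trace of \<alpha>^i times
  the same combination of powers. By non-degeneracy the two families have the same linear
  relations.\<close>

lemma sequence_condition_iff: "sequence_condition \<iota> t \<alpha> cs \<longleftrightarrow> subsets_indep"
proof -
  let ?s = "subinterval \<iota> t \<alpha> N"
  have combination: "(\<Sum>c\<in>D. fun_scale (a c) (?s c)) = 0 \<longleftrightarrow> (\<Sum>c\<in>D. \<iota> (a c) * \<alpha> ^ c) = 0" for a D
  proof -
    have eq: "(\<Sum>c\<in>D. fun_scale (a c) (?s c)) i
        = (if i < N then T (\<alpha> ^ i * (\<Sum>c\<in>D. \<iota> (a c) * \<alpha> ^ c)) else 0)" for i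
      by (simp add: sum_fun_apply fun_scale_def subinterval_def tuple_def sum_distrib_left trace_sum
          trace_scale_right power_add)
    show ?thesis
    proof
      assume zero: "(\<Sum>c\<in>D. fun_scale (a c) (?s c)) = 0"
      show "(\<Sum>c\<in>D. \<iota> (a c) * \<alpha> ^ c) = 0"
        by (rule trace_powers_eq_0) (use eq zero in \<open>metis zero_fun_apply\<close>)
    next
      assume "(\<Sum>c\<in>D. \<iota> (a c) * \<alpha> ^ c) = 0"
      then show "(\<Sum>c\<in>D. fun_scale (a c) (?s c)) = 0" by (intro ext) (simp only: eq, simp)
    qed
  qed
  \<comment> \<open>Distinct exponents give distinct sequences, so the set of sequences has
    \<open>length cs\<close> elements.\<close>
  have "inj_on ?s (set cs)"
  proof (rule inj_onI)
    fix c d assume cd: "c \<in> set cs" "d \<in> set cs" and eq: "?s c = ?s d"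
    have "T (\<alpha> ^ i * (\<alpha> ^ c - \<alpha> ^ d)) = 0" if "i < N" for i
      using fun_cong[OF eq, of i] that
      by (simp add: subinterval_def tuple_def right_diff_distrib trace_diff power_add)
    then have "\<alpha> ^ c - \<alpha> ^ d = 0" by (rule trace_powers_eq_0)
    then show "c = d" using inj_onD[OF power_inj_cs _ cd] by simp
  qed
  from is_ks_set_image_iff[OF vector_space_fun_scale finite_set this, of "t - 1"] length_cs
  show ?thesis
    by (simp add: sequence_condition_def card_cs card_base combination subsets_indep_def lin_indep_def
        q_power_t)
qed

lemma subsets_indep_columns:
  "subsets_indep \<longleftrightarrow>
     (\<forall>J\<subseteq>{..<length cs}. card J = t - 1 \<longrightarrow> lin_indep \<iota> (\<lambda>j. \<alpha> ^ (cs ! j)) J)"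
proof -
  have inj: "inj_on ((!) cs) {..<length cs}"
    using distinct_cs by (simp add: inj_on_nth)
  have cs: "set cs = (!) cs ` {..<length cs}"
    by (auto simp: set_conv_nth)
  have "subsets_indep \<longleftrightarrow>
     (\<forall>J\<subseteq>{..<length cs}. card ((!) cs ` J) = t - 1 \<longrightarrow> lin_indep \<iota> (\<lambda>c. \<alpha> ^ c) ((!) cs ` J))"
    unfolding subsets_indep_def cs by (auto simp: subset_image_iff)
  also have "\<dots> \<longleftrightarrow>
     (\<forall>J\<subseteq>{..<length cs}. card J = t - 1 \<longrightarrow> lin_indep \<iota> (\<lambda>j. \<alpha> ^ (cs ! j)) J)"
    using inj by (metis card_image inj_on_subset lin_indep_reindex[where x = "\<lambda>c. \<alpha> ^ c"])
  finally show ?thesis .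
qed

text \<open>Divisibility by the minimal polynomial means vanishing at \<alpha>, which is a linear
  relation between the powers \<open>\<alpha> ^ c j\<close>; the maps \<open>c\<close> enumerate the
  subsets of size \<open>t - 1\<close>.\<close>

lemma min_poly_condition_iff: "min_poly_condition \<iota> t \<alpha> cs \<longleftrightarrow> subsets_indep"
proof -
  let ?I = "{..t - 2}"
  have card_I: "card ?I = t - 1" using t_ge_2 by simp
  have "min_poly_condition \<iota> t \<alpha> cs \<longleftrightarrow>
     (\<forall>c. inj_on c ?I \<and> c ` ?I \<subseteq> set cs \<longrightarrow> lin_indep \<iota> (\<lambda>j. \<alpha> ^ c j) ?I)"
    unfolding min_poly_condition_def lin_indep_def min_poly_dvd_iff eval_sum eval_monom by auto
  also have "\<dots> \<longleftrightarrow> (\<forall>c. inj_on c ?I \<and> c ` ?I \<subseteq> set cs \<longrightarrow> lin_indep \<iota> (\<lambda>c. \<alpha> ^ c) (c ` ?I))"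
    by (rule all_cong1, rule imp_cong[OF refl], rule lin_indep_reindex[where x = "\<lambda>c. \<alpha> ^ c"]) simp
  also have "\<dots> \<longleftrightarrow> subsets_indep"
  proof
    assume *: "\<forall>c. inj_on c ?I \<and> c ` ?I \<subseteq> set cs \<longrightarrow> lin_indep \<iota> (\<lambda>c. \<alpha> ^ c) (c ` ?I)"
    show subsets_indep
      unfolding subsets_indep_def
    proof (intro allI impI)
      fix D assume "D \<subseteq> set cs" "card D = t - 1"
      then obtain c where "bij_betw c ?I D"
        using finite_same_card_bij[of ?I D] card_I by (metis List.finite_set finite_atMost finite_subset)
      then show "lin_indep \<iota> (\<lambda>c. \<alpha> ^ c) D"
        using * \<open>D \<subseteq> set cs\<close> unfolding bij_betw_def by blast
    qed
  next
    assume subsets_indep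
    then show "\<forall>c. inj_on c ?I \<and> c ` ?I \<subseteq> set cs \<longrightarrow> lin_indep \<iota> (\<lambda>c. \<alpha> ^ c) (c ` ?I)"
      unfolding subsets_indep_def using card_I by (metis card_image)
  qed
  finally show ?thesis .
qed

text \<open>Makes the field index the rows: the final all-zero row, of index \<open>N\<close>,
  corresponds to the element 0.\<close>

definition row_elem :: "nat \<Rightarrow> 'b" where
  "row_elem i = (if i < N then \<alpha> ^ i else 0)"

lemma row_elem_bij: "bij_betw row_elem {..<q ^ t} UNIV"
proof -
  have "row_elem ` {..<N} = UNIV - {0}"
    using prim_power_image by (auto simp: row_elem_def image_iff)
  then have "row_elem ` {..<q ^ t} = UNIV"
    unfolding q_power_t lessThan_Suc image_insert by (auto simp: row_elem_def[of N])
  moreover from this have "inj_on row_elem {..<q ^ t}"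
    by (intro eq_card_imp_inj_on) (simp_all add: card_ext)
  ultimately show ?thesis by (simp add: bij_betw_def)
qed

lemma array_zero_row: "array_zero \<iota> t \<alpha> cs i j = T (row_elem i * \<alpha> ^ (cs ! j))"
  by (simp add: array_zero_def row_elem_def card_base power_add q_power_t)

text \<open>The rows form the image of a linear map over the small field, sending \<open>z\<close>
  to the traces of \<open>z * \<alpha> ^ (cs ! j)\<close>.\<close>

lemma rows_subspace_array_zero: "rows_subspace (q ^ t) (length cs) (array_zero \<iota> t \<alpha> cs)"
proof -
  interpret V: vector_space "fun_scale :: 'a \<Rightarrow> _" by (rule vector_space_fun_scale)
  define row where "row z = tuple (length cs) (\<lambda>j. T (z * \<alpha> ^ (cs ! j)))" for z
  have "(\<lambda>i. tuple (length cs) (array_zero \<iota> t \<alpha> cs i)) ` {..<q ^ t} = row ` row_elem ` {..<q ^ t}"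
    by (simp add: image_image row_def flip: array_zero_row)
  also have "\<dots> = range row" using row_elem_bij by (simp add: bij_betw_def)
  finally have rows: "(\<lambda>i. tuple (length cs) (array_zero \<iota> t \<alpha> cs i)) ` {..<q ^ t} = range row" .
  have "row 0 = 0" "row y + row z = row (y + z)" "fun_scale a (row z) = row (\<iota> a * z)" for y z a
    by (auto simp: row_def tuple_def fun_eq_iff fun_scale_def trace_add distrib_right trace_scale mult.assoc)
  then have "V.subspace (range row)"
    unfolding V.subspace_def by (metis (no_types, lifting) rangeE rangeI)
  then show ?thesis by (simp add: rows_subspace_def rows)
qed

text \<open>Independence gives fibres of size \<open>q ^ t / q ^ (t - 1) = q\<close>. Conversely,
  when every unit vector occurs as a trace vector, pairing it with a relation reads off one
  coefficient, which must vanish.\<close>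

lemma orthogonal_array_iff:
  "orthogonal_array (q ^ t) q (t - 1) (length cs) q UNIV (array_zero \<iota> t \<alpha> cs) \<longleftrightarrow> subsets_indep"
proof -
  let ?x = "\<lambda>j. \<alpha> ^ (cs ! j)"
  have rows: "card {i. i < q ^ t \<and> (\<forall>j\<in>J. array_zero \<iota> t \<alpha> cs i j = f j)}
      = card {z. \<forall>j\<in>J. T (z * ?x j) = f j}" for J f
  proof -
    have "{z. \<forall>j\<in>J. T (z * ?x j) = f j}
        = row_elem ` {i. i < q ^ t \<and> (\<forall>j\<in>J. array_zero \<iota> t \<alpha> cs i j = f j)}"
      using bij_betw_imp_surj_on[OF row_elem_bij] unfolding array_zero_row
      by (auto simp: image_iff set_eq_iff) (metis lessThan_iff)
    moreover have "inj_on row_elem {i. i < q ^ t \<and> (\<forall>j\<in>J. array_zero \<iota> t \<alpha> cs i j = f j)}"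
      by (rule inj_on_subset[OF bij_betw_imp_inj_on[OF row_elem_bij]]) auto
    ultimately show ?thesis by (simp add: card_image)
  qed
  have qt: "q ^ t = q * q ^ (t - 1)" using t_ge_2 by (cases t) auto
  have "orthogonal_array (q ^ t) q (t - 1) (length cs) q UNIV (array_zero \<iota> t \<alpha> cs) \<longleftrightarrow>
     (\<forall>J\<subseteq>{..<length cs}. card J = t - 1 \<longrightarrow>
        (\<forall>f\<in>J \<rightarrow>\<^sub>E (UNIV :: 'a set). card {z. \<forall>j\<in>J. T (z * ?x j) = f j} = q))"
    unfolding orthogonal_array_def rows using length_cs qt by (simp add: card_base)
  also have "\<dots> \<longleftrightarrow> (\<forall>J\<subseteq>{..<length cs}. card J = t - 1 \<longrightarrow> lin_indep \<iota> ?x J)"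
  proof (rule all_cong1, rule imp_cong[OF refl], rule imp_cong[OF refl], rule iffI)
    fix J assume J: "J \<subseteq> {..<length cs}" "card J = t - 1" and indep: "lin_indep \<iota> ?x J"
    show "\<forall>f\<in>J \<rightarrow>\<^sub>E (UNIV :: 'a set). card {z. \<forall>j\<in>J. T (z * ?x j) = f j} = q"
      using trace_fibre_card[OF finite_subset[OF J(1) finite_lessThan] indep] q_ge_2 qt J(2) by simp
  next
    fix J assume J: "J \<subseteq> {..<length cs}" "card J = t - 1"
      and fibres: "\<forall>f\<in>J \<rightarrow>\<^sub>E (UNIV :: 'a set). card {z. \<forall>j\<in>J. T (z * ?x j) = f j} = q"
    show "lin_indep \<iota> ?x J"
      unfolding lin_indep_def
    proof (intro allI impI ballI)
      fix a i assume zero: "(\<Sum>j\<in>J. \<iota> (a j) * ?x j) = 0" and "i \<in> J"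
      define f where "f = (\<lambda>j\<in>J. if j = i then 1 else (0::'a))"
      have "f \<in> J \<rightarrow>\<^sub>E UNIV" by (simp add: f_def)
      then have "card {z. \<forall>j\<in>J. T (z * ?x j) = f j} = q" using fibres by blast
      then have "card {z. \<forall>j\<in>J. T (z * ?x j) = f j} \<noteq> 0" using q_ge_2 by simp
      then obtain z where z: "\<And>j. j \<in> J \<Longrightarrow> T (z * ?x j) = f j"
        by (metis (mono_tags, lifting) card_eq_0_iff equals0I mem_Collect_eq)
      have "0 = T (z * (\<Sum>j\<in>J. \<iota> (a j) * ?x j))" by (simp add: zero)
      also have "\<dots> = (\<Sum>j\<in>J. a j * f j)"
        by (simp add: sum_distrib_left trace_sum trace_scale_right z)
      also have "\<dots> = (\<Sum>j\<in>J. if j = i then a j else 0)"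
        by (rule sum.cong) (auto simp: f_def)
      also have "\<dots> = a i"
        using \<open>i \<in> J\<close> finite_subset[OF J(1)] by simp
      finally show "a i = 0" by simp
    qed
  qed
  finally show ?thesis by (simp add: subsets_indep_columns)
qed

text \<open>Distinct exponents give distinct non-zero powers, so
  \<open>dependent_iff_in_flat\<close> applies to the powers indexed by \<open>D\<close>.\<close>

lemma flat_condition_iff: "flat_condition \<iota> t \<alpha> cs \<longleftrightarrow> subsets_indep"
proof -
  have "(\<exists>F. is_flat \<iota> (int t - 3) F \<and> (\<forall>c\<in>D. proj_point \<iota> (\<alpha> ^ c) \<in> F)) \<longleftrightarrow> \<not> lin_indep \<iota> (\<lambda>c. \<alpha> ^ c) D"
    if D: "D \<subseteq> set cs" "card D = t - 1" for D
  proof -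
    have fin: "finite D" using D(1) by (rule finite_subset) simp
    have inj: "inj_on (\<lambda>c. \<alpha> ^ c) D" by (rule inj_on_subset[OF power_inj_cs D(1)])
    have "\<not> module.dependent (ext_scale \<iota>) ((\<lambda>c. \<alpha> ^ c) ` D) \<longleftrightarrow> lin_indep \<iota> (\<lambda>c. \<alpha> ^ c) D"
      using independent_image_iff[OF vector_space_ext_scale[OF emb] fin inj]
      by (simp add: lin_indep_def ext_scale_def)
    moreover have "module.dependent (ext_scale \<iota>) ((\<lambda>c. \<alpha> ^ c) ` D) \<longleftrightarrow>
      (\<exists>F. is_flat \<iota> (int t - 3) F \<and> proj_point \<iota> ` (\<lambda>c. \<alpha> ^ c) ` D \<subseteq> F)"
      by (rule dependent_iff_in_flat) (use fin inj D t_ge_2 in \<open>auto simp: card_image\<close>)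
    moreover have "\<dots> \<longleftrightarrow> (\<exists>F. is_flat \<iota> (int t - 3) F \<and> (\<forall>c\<in>D. proj_point \<iota> (\<alpha> ^ c) \<in> F))"
      by (simp add: image_subset_iff)
    ultimately show ?thesis by argo
  qed
  then show ?thesis
    unfolding flat_condition_def subsets_indep_def
    by (intro all_cong1 imp_cong[OF refl]) simp
qed

end

section \<open>Covering arrays\<close>

text \<open>With \<open>n = t - 1\<close> and \<open>m * v = q - 1\<close>, multiplying the
  hypothesis by \<open>q powr (t / 2)\<close> bounds \<open>v ^ n * q powr (t / 2)\<close> by
  \<open>q ^ (n - 1) * (q - t * v)\<close>. This is less than \<open>q ^ (n - 1) * (q - n)\<close>,
  which Bernoulli bounds by \<open>(q - 1) ^ n = (m * v) ^ n\<close>. Cancelling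
  \<open>v ^ n\<close> and squaring finishes.\<close>

lemma subgroup_size_bound:
  fixes q t v :: nat
  assumes "q \<ge> 2" "t \<ge> 2" "v > 0" "v dvd q - 1"
    and bound: "real q powr (real t / 2 - 2) * (real q - real t * real v) \<ge> real v ^ (t - 1)"
  shows "((q - 1) div v) ^ (2 * (t - 1)) > q ^ t"
proof -
  define Q m n where "Q = real q" and "m = real ((q - 1) div v)" and "n = t - 1"
  have Q: "Q \<ge> 2" using assms by (simp add: Q_def)
  have t: "real t = real n + 1" "n \<ge> 1" using assms by (auto simp: n_def)
  have "real ((q - 1) div v * v) = real (q - 1)" using \<open>v dvd q - 1\<close> by simp
  then have mv: "m * real v = Q - 1" using assms by (simp add: m_def Q_def)
  have "real v ^ n * Q powr (t / 2) \<le> Q powr (real t / 2 - 2) * (Q - t * real v) * Q powr (t / 2)"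
    using bound by (simp add: Q_def n_def mult_right_mono)
  also have "\<dots> = Q powr (real (n - 1)) * (Q - t * real v)"
  proof -
    have "Q powr (real t / 2 - 2) * Q powr (t / 2) = Q powr (real (n - 1))"
      using t by (simp add: of_nat_diff flip: powr_add)
    then show ?thesis by (simp add: mult_ac)
  qed
  also have "Q powr (real (n - 1)) = Q ^ (n - 1)" using Q by (simp add: powr_realpow)
  also have "Q ^ (n - 1) * (Q - t * real v) < Q ^ (n - 1) * (Q - n)"
  proof -
    have "real n < real t" using t by simp
    also have "\<dots> \<le> real t * real v" using \<open>v > 0\<close> mult_left_mono[of 1 "real v" "real t"] by simp
    finally show ?thesis using Q by simp
  qed
  also have "\<dots> = Q ^ n * (1 + real n * (- 1 / Q))"
    using t Q by (cases n) (simp_all add: field_simps)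
  also have "\<dots> \<le> Q ^ n * (1 + (- 1 / Q)) ^ n"
    using Q by (intro mult_left_mono Bernoulli_inequality) auto
  also have "\<dots> = (Q - 1) ^ n"
    using Q by (simp add: field_simps flip: power_mult_distrib)
  also have "\<dots> = m ^ n * real v ^ n" by (simp add: mv flip: power_mult_distrib)
  finally have "Q powr (t / 2) < m ^ n" using \<open>v > 0\<close> by (simp add: mult.commute)
  then have "(Q powr (t / 2)) ^ 2 < (m ^ n) ^ 2" by (intro power_strict_mono) auto
  moreover have "(Q powr (t / 2)) ^ 2 = Q ^ t"
    using Q by (simp add: powr_realpow power2_eq_square flip: powr_add)
  ultimately have "Q ^ t < m ^ (2 * n)" by (simp add: power_mult mult.commute)
  then have "real (q ^ t) < real (((q - 1) div v) ^ (2 * (t - 1)))"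
    by (simp add: Q_def m_def n_def)
  then show ?thesis by linarith
qed

section \<open>The element \<omega> and logarithms modulo \<open>v\<close>\<close>

context primitive_extension
begin

abbreviation "\<omega> \<equiv> omega \<iota> t \<alpha>"

lemma qnum_mult: "qnum q t * (q - 1) = N"
proof -
  \<comment> \<open>This makes the truncating \<open>div\<close> in \<open>qnum\<close>
    exact.\<close>
  have "q - 1 dvd q ^ n - 1" for n
  proof (induction n)
    case (Suc n)
    have "q ^ Suc n - 1 = q * (q ^ n - 1) + (q - 1)"
      using q_ge_2 by (simp add: algebra_simps diff_mult_distrib2)
    then show ?case using Suc by simp
  qed simp
  then show ?thesis by (simp add: qnum_def N_def)
qed

text \<open>Raising this power of \<alpha> to \<open>q\<close> multiplies it by
  \<open>\<alpha> ^ N = 1\<close>. It therefore lies in the range of \<iota>, where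
  \<open>inv \<iota>\<close> is a true preimage.\<close>

lemma emb_omega: "\<iota> \<omega> = \<alpha> ^ qnum q t"
proof -
  have "(\<alpha> ^ qnum q t) ^ q = \<alpha> ^ (N + qnum q t)"
    using q_ge_2 by (simp add: algebra_simps flip: qnum_mult power_mult)
  also have "\<dots> = \<alpha> ^ qnum q t" by (simp add: power_add prim_power_N)
  finally have "\<alpha> ^ qnum q t \<in> range \<iota>" by (simp add: range_emb)
  then show ?thesis by (simp add: omega_def card_base f_inv_into_f)
qed

lemma omega_nonzero [simp]: "\<omega> \<noteq> 0"
  using emb_omega by (metis emb_0 power_not_zero prim_nonzero)

lemma omega_power_order: "\<omega> ^ (q - 1) = 1"
proof -
  have "\<iota> (\<omega> ^ (q - 1)) = \<iota> 1"
    by (simp add: emb_power emb_omega qnum_mult prim_power_N del: One_nat_def flip: power_mult)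
  then show ?thesis by (simp only: emb_eq_iff)
qed

lemma omega_power_mod: "\<omega> ^ (n mod (q - 1)) = \<omega> ^ n"
proof -
  have "\<omega> ^ n = \<omega> ^ ((q - 1) * (n div (q - 1)) + n mod (q - 1))" by simp
  also have "\<dots> = \<omega> ^ (n mod (q - 1))" by (simp only: power_add power_mult omega_power_order) simp
  finally show ?thesis by simp
qed

text \<open>If \<iota> a = \<alpha>^i with \<open>a \<noteq> 0\<close>, then
  \<open>a ^ (q - 1) = 1\<close> makes \<open>N = qnum q t * (q - 1)\<close> divide
  \<open>i * (q - 1)\<close>. Hence \<open>qnum q t\<close> divides \<open>i\<close>, and
  \<open>a\<close> is a power of \<omega>.\<close>

lemma omega_power_image: "(\<lambda>n. \<omega> ^ n) ` {..<q - 1} = UNIV - {0}"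
proof
  show "(\<lambda>n. \<omega> ^ n) ` {..<q - 1} \<subseteq> UNIV - {0}" by auto
  show "UNIV - {0} \<subseteq> (\<lambda>n. \<omega> ^ n) ` {..<q - 1}"
  proof
    fix a :: 'a assume "a \<in> UNIV - {0}"
    then have "\<iota> a \<noteq> 0" by simp
    then obtain i where i: "i < N" "\<iota> a = \<alpha> ^ i" by (rule prim_powerE)
    have "\<alpha> ^ (i * (q - 1)) * \<iota> a = 1 * \<iota> a"
    proof -
      have "\<alpha> ^ (i * (q - 1)) * \<iota> a = \<iota> a ^ Suc (q - 1)" by (simp add: i power_mult)
      also have "Suc (q - 1) = q" using q_ge_2 by simp
      finally show ?thesis by (simp add: emb_power_q)
    qed
    then have "\<alpha> ^ ((i * (q - 1)) mod N) = \<alpha> ^ 0"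
      using \<open>\<iota> a \<noteq> 0\<close> by (simp add: prim_power_mod)
    then have "(i * (q - 1)) mod N = 0"
      using inj_onD[OF prim_power_inj] N_pos by (metis lessThan_iff mod_less_divisor)
    then have "qnum q t * (q - 1) dvd i * (q - 1)" by (simp only: qnum_mult mod_eq_0_iff_dvd)
    then have "qnum q t dvd i" using q_ge_2 by simp
    then obtain k where "i = qnum q t * k" by (elim dvdE)
    then have "\<iota> a = \<iota> (\<omega> ^ k)" by (simp add: i emb_power emb_omega power_mult)
    then have "a = \<omega> ^ (k mod (q - 1))" by (simp only: emb_eq_iff omega_power_mod)
    then show "a \<in> (\<lambda>n. \<omega> ^ n) ` {..<q - 1}" using q_ge_2 by auto
  qed
qed

lemma omega_power_inj: "inj_on (\<lambda>n. \<omega> ^ n) {..<q - 1}"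
  by (rule eq_card_imp_inj_on) (simp_all add: omega_power_image card_Diff_singleton card_base
      del: One_nat_def)

lemma dlog_omega_power: "dlog \<omega> (\<omega> ^ n) = n mod (q - 1)"
  unfolding dlog_def card_base
proof (rule the_equality)
  have "n mod (q - 1) < q - 1" using q_ge_2 by simp
  then have "n mod (q - 1) \<le> q - 2" by arith
  then show "n mod (q - 1) \<le> q - 2 \<and> \<omega> ^ (n mod (q - 1)) = \<omega> ^ n"
    by (simp only: omega_power_mod)
next
  fix j assume j: "j \<le> q - 2 \<and> \<omega> ^ j = \<omega> ^ n"
  then have "\<omega> ^ j = \<omega> ^ (n mod (q - 1))" by (simp only: omega_power_mod)
  then show "j = n mod (q - 1)"
    by (rule inj_onD[OF omega_power_inj]) (use j q_ge_2 in \<open>auto simp del: One_nat_def\<close>)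
qed

lemma nonzero_omega_power:
  assumes "a \<noteq> 0"
  obtains n where "a = \<omega> ^ n"
  using assms omega_power_image by (metis Diff_iff UNIV_I empty_iff imageE insert_iff)

lemma dlog_mod_omega_power:
  assumes "v dvd q - 1"
  shows "dlog \<omega> (\<omega> ^ n) mod v = n mod v"
  by (simp only: dlog_omega_power mod_mod_cancel[OF assms])

text \<open>Raising the row index by \<open>v * qnum q t\<close> multiplies the trace by
  \<open>\<omega> ^ v\<close>. A non-zero trace keeps its logarithm modulo \<open>v\<close>, and a
  zero trace keeps the default entry 0.\<close>

lemma array_log_mod:
  assumes "v dvd q - 1"
  shows "array_log \<iota> t \<alpha> cs v (i mod (v * qnum q t)) j = array_log \<iota> t \<alpha> cs v i j"
proof -
  define r s where "r = i mod (v * qnum q t)" and "s = i div (v * qnum q t)"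
  have "i = r + qnum q t * (v * s)"
    by (simp add: r_def s_def) (metis mod_mult_div_eq mult.assoc mult.commute)
  then have "\<alpha> ^ (i + cs ! j) = \<iota> (\<omega> ^ (v * s)) * \<alpha> ^ (r + cs ! j)"
    by (simp add: emb_power emb_omega power_add power_mult)
  then have T: "T (\<alpha> ^ (i + cs ! j)) = \<omega> ^ (v * s) * T (\<alpha> ^ (r + cs ! j))"
    by (simp only: trace_scale)
  show ?thesis
  proof (cases "T (\<alpha> ^ (r + cs ! j)) = 0")
    case False
    then obtain n where n: "T (\<alpha> ^ (r + cs ! j)) = \<omega> ^ n" by (rule nonzero_omega_power)
    then have "T (\<alpha> ^ (i + cs ! j)) = \<omega> ^ (v * s + n)" by (simp only: T n power_add[of \<omega>])
    then show ?thesis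
      unfolding array_log_def r_def[symmetric] n by (simp add: dlog_mod_omega_power[OF assms])
  qed (simp add: array_log_def T r_def)
qed

text \<open>Handles one choice of \<open>t\<close> columns and one target \<open>f\<close>: the
  trace in column \<open>j\<close> must have logarithm congruent to \<open>f j\<close> modulo
  \<open>v\<close>.\<close>

lemma trace_log_residues:
  fixes x :: "'i \<Rightarrow> 'b"
  assumes J: "finite J" "card J = t" and indep: "\<And>j. j \<in> J \<Longrightarrow> lin_indep \<iota> x (J - {j})"
    and "v > 0" "v dvd q - 1" and large: "((q - 1) div v) ^ (2 * (t - 1)) > q ^ t"
  shows "\<exists>z. \<forall>j\<in>J. \<exists>n. T (z * x j) = \<omega> ^ (f j + v * n)"
proof (cases "lin_indep \<iota> x J")
  case True
  obtain z where "\<And>j. j \<in> J \<Longrightarrow> T (z * x j) = \<omega> ^ f j"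
    using trace_interpolation[OF J(1) True, of "\<lambda>j. \<omega> ^ f j"] by auto
  then show ?thesis by (intro exI[of _ z] ballI exI[of _ 0]) simp
next
  case False
  then obtain a i where zero: "(\<Sum>j\<in>J. \<iota> (a j) * x j) = 0" and i: "i \<in> J" "a i \<noteq> 0"
    by (auto simp: lin_indep_def)
  \<comment> \<open>A vanishing coefficient would leave a non-trivial relation among the other
    \<open>t - 1\<close> vectors.\<close>
  have a: "a j \<noteq> 0" if "j \<in> J" for j
  proof
    assume "a j = 0"
    then have "(\<Sum>j\<in>J - {j}. \<iota> (a j) * x j) = 0"
      using zero that J(1) by (simp add: sum.remove)
    from lin_indepD[OF indep[OF that] this, of i] show False using i \<open>a j = 0\<close> by auto
  qed
  \<comment> \<open>The group of \<open>v\<close>-th powers; a residue of the logarithm modulo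
    \<open>v\<close> selects one of its cosets.\<close>
  define K where "K = range (\<lambda>n. \<omega> ^ (v * n))"
  have K_mult: "y * z \<in> K" if "y \<in> K" "z \<in> K" for y z
    using that unfolding K_def by (auto simp: image_iff simp flip: power_add distrib_left)
  \<comment> \<open>Exponents \<open>v * n\<close> below \<open>q - 1\<close> give distinct powers,
    so \<open>K\<close> has at least \<open>(q - 1) div v\<close> elements.\<close>
  have "card ((\<lambda>n. \<omega> ^ (v * n)) ` {..<(q - 1) div v}) = (q - 1) div v"
  proof (subst card_image)
    show "inj_on (\<lambda>n. \<omega> ^ (v * n)) {..<(q - 1) div v}"
    proof (rule inj_onI)
      fix k l assume kl: "k \<in> {..<(q - 1) div v}" "l \<in> {..<(q - 1) div v}" "\<omega> ^ (v * k) = \<omega> ^ (v * l)"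
      have "v * k < q - 1" "v * l < q - 1"
        using kl(1,2) \<open>v dvd q - 1\<close> \<open>v > 0\<close> by (auto elim!: dvdE)
      then have "v * k = v * l" using inj_onD[OF omega_power_inj kl(3)] by simp
      then show "k = l" using \<open>v > 0\<close> by simp
    qed
  qed simp
  moreover have "card ((\<lambda>n. \<omega> ^ (v * n)) ` {..<(q - 1) div v}) \<le> card K"
    by (rule card_mono) (auto simp: K_def)
  ultimately have "((q - 1) div v) ^ (2 * (t - 1)) \<le> card K ^ (2 * (t - 1))"
    by (intro power_mono) auto
  then have "CARD('a) ^ card J < card K ^ (2 * (card J - 1))"
    using large by (simp add: card_base J)
  moreover have "0 \<notin> K" "K \<noteq> {}" by (auto simp: K_def)
  \<comment> \<open>The prescribed coset is absorbed into the coefficient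
    \<open>a j * \<omega> ^ f j\<close>, which leaves unknowns in \<open>K\<close> itself.\<close>
  ultimately have "\<exists>y. y ` J \<subseteq> K \<and> (\<Sum>j\<in>J. a j * \<omega> ^ f j * y j) = 0"
    using K_mult J t_ge_2 a by (intro diagonal_equation_solvable) simp_all
  then obtain y where y: "y ` J \<subseteq> K" "(\<Sum>j\<in>J. a j * \<omega> ^ f j * y j) = 0" by blast
  \<comment> \<open>Interpolation prescribes the traces away from \<open>i\<close>; the relation
    then forces the remaining one.\<close>
  obtain z where z: "\<And>j. j \<in> J - {i} \<Longrightarrow> T (z * x j) = \<omega> ^ f j * y j"
    using trace_interpolation[OF _ indep[OF i(1)], of "\<lambda>j. \<omega> ^ f j * y j"] J(1) by auto
  have "0 = T (z * (\<Sum>j\<in>J. \<iota> (a j) * x j))" by (simp add: zero)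
  also have "\<dots> = (\<Sum>j\<in>J. a j * T (z * x j))"
    by (simp add: sum_distrib_left trace_sum trace_scale_right)
  also have "\<dots> = a i * T (z * x i) + (\<Sum>j\<in>J - {i}. a j * \<omega> ^ f j * y j)"
    using J(1) i(1) z by (simp add: sum.remove mult.assoc)
  also have "\<dots> = a i * T (z * x i) - a i * \<omega> ^ f i * y i"
    using y(2) J(1) i(1) by (simp add: sum.remove eq_neg_iff_add_eq_0 add.commute)
  finally have "T (z * x i) = \<omega> ^ f i * y i" using i(2) by (simp add: mult.assoc)
  then have Tz: "T (z * x j) = \<omega> ^ f j * y j" if "j \<in> J" for j
    using z that by (cases "j = i") auto
  have "\<exists>n. T (z * x j) = \<omega> ^ (f j + v * n)" if "j \<in> J" for j
  proof -
    have "y j \<in> K" using y(1) that by auto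
    then obtain n where "y j = \<omega> ^ (v * n)" by (auto simp: K_def)
    then show ?thesis using Tz[OF that] by (auto simp: power_add)
  qed
  then show ?thesis by blast
qed

end

section \<open>The covering array\<close>

context exponent_list
begin

lemma covering_array_log:
  assumes "subsets_indep" "t \<le> length cs" "v > 0" "v dvd q - 1"
    and large: "((q - 1) div v) ^ (2 * (t - 1)) > q ^ t"
  shows "covering_array (v * qnum q t) t (length cs) v {..<v} (array_log \<iota> t \<alpha> cs v)"
  unfolding covering_array_def
proof (intro conjI allI impI ballI)
  show "array_log \<iota> t \<alpha> cs v i j \<in> {..<v}" for i j
    using \<open>v > 0\<close> by (simp add: array_log_def Let_def)
next
  fix J f assume J: "J \<subseteq> {..<length cs}" "card J = t" and f: "f \<in> J \<rightarrow>\<^sub>E {..<v}"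
  have fin: "finite J" using J(1) by (rule finite_subset) simp
  have "lin_indep \<iota> (\<lambda>j. \<alpha> ^ (cs ! j)) (J - {j})" if "j \<in> J" for j
  proof -
    have "card (J - {j}) = t - 1" using J(2) fin that by simp
    then show ?thesis using \<open>subsets_indep\<close> J(1) unfolding subsets_indep_columns by blast
  qed
  then obtain z where z: "\<And>j. j \<in> J \<Longrightarrow> \<exists>n. T (z * \<alpha> ^ (cs ! j)) = \<omega> ^ (f j + v * n)"
    using trace_log_residues[OF fin J(2) _ \<open>v > 0\<close> \<open>v dvd q - 1\<close> large, of "\<lambda>j. \<alpha> ^ (cs ! j)" f]
    by blast
  \<comment> \<open>In any column of \<open>J\<close> the trace is a power of \<omega>, hence
    non-zero; so \<open>z\<close> is non-zero and a power of \<alpha>.\<close>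
  have "J \<noteq> {}" using J t_ge_2 by auto
  then have "z \<noteq> 0" using z by fastforce
  then obtain i where i: "z = \<alpha> ^ i" by (rule prim_powerE)
  have "array_log \<iota> t \<alpha> cs v i j = f j" if j: "j \<in> J" for j
  proof -
    obtain n where "T (\<alpha> ^ (i + cs ! j)) = \<omega> ^ (f j + v * n)"
      using z[OF j] by (auto simp: i power_add)
    then have "array_log \<iota> t \<alpha> cs v i j = (f j + v * n) mod v"
      using dlog_mod_omega_power[OF \<open>v dvd q - 1\<close>] by (simp add: array_log_def)
    also have "\<dots> = f j" using PiE_mem[OF f j] by simp
    finally show ?thesis .
  qed
  moreover have "v * qnum q t > 0"
    using \<open>v > 0\<close> qnum_mult N_pos by (metis mult_eq_0_iff neq0_conv)
  ultimately show "\<exists>i<v * qnum q t. \<forall>j\<in>J. array_log \<iota> t \<alpha> cs v i j = f j"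
    using array_log_mod[OF \<open>v dvd q - 1\<close>] by (intro exI[of _ "i mod (v * qnum q t)"]) simp
qed (use assms in auto)

end

text \<open>Linearity of an array includes distinct rows, which fails exactly when the powers of
  \<alpha> do not span the large field, as for \<open>length cs = t - 1\<close>. The first conjunct
  therefore states row distinctness explicitly, and the second relates the remaining array
  properties to the other conditions. Strength \<open>t\<close> of the covering array requires
  \<open>t \<le> length cs\<close>.\<close>

theorem mainTheorem1:
  fixes \<iota> :: "'f::{field,finite} \<Rightarrow> 'e::{field,finite}"
    and \<alpha> :: 'e
    and q t v :: nat
    and cs :: "nat list"
  assumes "CARD('f) = q" and "CARD('e) = q ^ t" and "field_embedding \<iota>"
    and "t \<ge> 2"
    and "primitive_element \<alpha>"
    and "v > 0" and "v dvd q - 1"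
    and "distinct cs" and "set cs \<subseteq> {0..q ^ t - 2}"
    and "t - 1 \<le> length cs"
  shows "(linear_oa_condition \<iota> t \<alpha> cs \<longleftrightarrow>
            power_set_condition \<iota> t \<alpha> cs \<and>
            rows_distinct (q ^ t) (length cs) (array_zero \<iota> t \<alpha> cs)) \<and>
         (orthogonal_array (q ^ t) q (t - 1) (length cs) q UNIV (array_zero \<iota> t \<alpha> cs) \<and>
            rows_subspace (q ^ t) (length cs) (array_zero \<iota> t \<alpha> cs) \<longleftrightarrow>
            power_set_condition \<iota> t \<alpha> cs) \<and>
         (power_set_condition \<iota> t \<alpha> cs \<longleftrightarrow> sequence_condition \<iota> t \<alpha> cs) \<and>
         (sequence_condition \<iota> t \<alpha> cs \<longleftrightarrow> min_poly_condition \<iota> t \<alpha> cs) \<and>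
         (min_poly_condition \<iota> t \<alpha> cs \<longleftrightarrow> flat_condition \<iota> t \<alpha> cs) \<and>
         (t \<le> length cs \<longrightarrow>
          linear_oa_condition \<iota> t \<alpha> cs \<or> power_set_condition \<iota> t \<alpha> cs \<or>
            sequence_condition \<iota> t \<alpha> cs \<or> min_poly_condition \<iota> t \<alpha> cs \<or>
            flat_condition \<iota> t \<alpha> cs \<longrightarrow>
          real q powr (real t / 2 - 2) * (real q - real t * real v) \<ge> real v ^ (t - 1) \<longrightarrow>
          covering_array (v * qnum q t) t (length cs) v {..<v} (array_log \<iota> t \<alpha> cs v))"
proof -
  interpret primitive_extension \<iota> q t \<alpha>
    by unfold_locales (use assms in auto)
  \<comment> \<open>As \<open>N > 0\<close>, the bound \<open>q ^ t - 2\<close> on the exponents is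
    \<open>N - 1\<close>.\<close>
  interpret exponent_list \<iota> q t \<alpha> cs
    by unfold_locales (use assms N_pos in \<open>auto simp: N_def subset_iff\<close>)
  have linear: "linear_oa_condition \<iota> t \<alpha> cs \<longleftrightarrow>
      subsets_indep \<and> rows_distinct (q ^ t) (length cs) (array_zero \<iota> t \<alpha> cs)"
    using orthogonal_array_iff rows_subspace_array_zero
    by (auto simp: linear_oa_condition_def linear_orthogonal_array_def assms(1))
  show ?thesis
    using covering_array_log[OF _ _ \<open>v > 0\<close> \<open>v dvd q - 1\<close>]
      subgroup_size_bound[OF q_ge_2 \<open>t \<ge> 2\<close> \<open>v > 0\<close> \<open>v dvd q - 1\<close>]
      rows_subspace_array_zero
    unfolding linear orthogonal_array_iff power_set_condition_iff sequence_condition_iff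
      min_poly_condition_iff flat_condition_iff
    by blast
qed

end
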